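(* Let $G$ and $H$ be infinite finitely generated residually finite groups, and let $X$ and $Y$ be free exact odometers of $G$ and $H$, respectively. If $(X,\alpha_X,G)$ and $(Y,\alpha_Y,H)$ are continuously orbit equivalent, then $\mathrm{Aut}^{\infty}(X,\alpha_X,G)\cong \mathrm{Aut}^{\infty}(Y,\alpha_Y,H)$ as abstract groups. The converse is not true: there exist infinite finitely generated residually finite groups $G,H$ and free exact odometers $X$ of $G$ and $Y$ of $H$ such that $\mathrm{Aut}^{\infty}(X,\alpha_X,G)\cong \mathrm{Aut}^{\infty}(Y,\alpha_Y,H)$ but $(X,\alpha_X,G)$ and $(Y,\alpha_Y,H)$ are not continuously orbit equivalent.
   Context: Let $G$ be a countable group. A scale of $G$ is a decreasing sequence $(\Gamma_n)_{n\in\mathbb{N}}$ of normal finite-index subgroups of $G$ with $\bigcap_n\Gamma_n=\{1_G\}$. The free exact odometer associated with the scale is $X=G_{(\Gamma_n)}=\{(x_n)_n\in\prod_n G/\Gamma_n : x_{n+1}\mapsto x_n \text{ under } G/\Gamma_{n+1}\to G/\Gamma_n \text{ for all } n\}$, a subgroup of the product group with the topology induced by the product of the discrete topologies. A free exact odometer of $G$ is one associated with some scale of $G$. The injective homomorphism $\tau:G\to X$, $\tau(g)=(g\Gamma_n)_n$, has dense image, and $\alpha_X$ is the action of $G$ on $X$ given by $\alpha_X^g(x)=\tau(g)x$. For an action $\alpha$ of a group $G$ on $X$ by homeomorphisms, $\mathrm{Aut}(X,\alpha,G)$ is the group of homeomorphisms $f$ of $X$ with $f\circ\alpha^g=\alpha^g\circ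 f$ for all $g\in G$. The stabilized automorphism group is $\mathrm{Aut}^\infty(X,\alpha,G)=\bigcup_{K}\mathrm{Aut}(X,\alpha|_K,K)$, the union over all finite-index subgroups $K$ of $G$, where $\alpha|_K$ is the restriction of the action to $K$. Topological dynamical systems $(X,\alpha,G)$ and $(Y,\beta,H)$ are continuously orbit equivalent if there is a homeomorphism $\varphi:X\to Y$ that induces a bijection between the orbits of $\alpha$ and those of $\beta$ and such that for every $g\in G$ and $x\in X$ there exist a clopen neighborhood $U$ of $x$ and $h\in H$ with $\varphi(\alpha^g(y))=\beta^h(\varphi(y))$ for all $y\in U$. *)

theory Defs
  imports "HOL-Analysis.Abstract_Topology" "HOL-Analysis.Function_Topology" "HOL-Algebra.Algebra"
begin

section \<open>Finiteness conditions on groups\<close>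

definition finite_index_subgroup :: "'a set \<Rightarrow> ('a, 'm) monoid_scheme \<Rightarrow> bool"
  where "finite_index_subgroup K G \<longleftrightarrow> subgroup K G \<and> finite (rcosets\<^bsub>G\<^esub> K)"

definition finitely_generated_group :: "('a, 'm) monoid_scheme \<Rightarrow> bool"
  where "finitely_generated_group G \<longleftrightarrow>
    group G \<and> (\<exists>S. finite S \<and> S \<subseteq> carrier G \<and> generate G S = carrier G)"

definition residually_finite_group :: "('a, 'm) monoid_scheme \<Rightarrow> bool"
  where "residually_finite_group G \<longleftrightarrow>
    group G \<and> (\<forall>g\<in>carrier G. g \<noteq> \<one>\<^bsub>G\<^esub> \<longrightarrow>
      (\<exists>N. N \<lhd> G \<and> finite_index_subgroup N G \<and> g \<notin> N))"

section \<open>Free exact odometers\<close>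

definition group_scale :: "('a, 'm) monoid_scheme \<Rightarrow> (nat \<Rightarrow> 'a set) \<Rightarrow> bool"
  where "group_scale G \<Gamma> \<longleftrightarrow>
    (\<forall>n. \<Gamma> n \<lhd> G \<and> finite_index_subgroup (\<Gamma> n) G) \<and> decseq \<Gamma> \<and> (\<Inter>n. \<Gamma> n) = {\<one>\<^bsub>G\<^esub>}"

text \<open>
  The map \<open>G Mod \<Gamma> (n + 1) \<rightarrow> G Mod \<Gamma> n\<close> sends a coset \<open>C\<close> to the product set \<open>\<Gamma> n \<cdot> C\<close>;
  see \<open>bonding_coset\<close>. As the subgroups are normal, the right cosets used by the library
  are also the left cosets.
\<close>

definition bonding :: "('a, 'm) monoid_scheme \<Rightarrow> (nat \<Rightarrow> 'a set) \<Rightarrow> nat \<Rightarrow> 'a set \<Rightarrow> 'a set"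
  where "bonding G \<Gamma> n C = \<Gamma> n <#>\<^bsub>G\<^esub> C"

definition odometer :: "('a, 'm) monoid_scheme \<Rightarrow> (nat \<Rightarrow> 'a set) \<Rightarrow> (nat \<Rightarrow> 'a set) set"
  where "odometer G \<Gamma> =
    {x \<in> carrier (product_group UNIV (\<lambda>n. G Mod \<Gamma> n)). \<forall>n. bonding G \<Gamma> n (x (Suc n)) = x n}"

definition odometer_group ::
    "('a, 'm) monoid_scheme \<Rightarrow> (nat \<Rightarrow> 'a set) \<Rightarrow> (nat \<Rightarrow> 'a set) monoid"
  where "odometer_group G \<Gamma> =
    (product_group UNIV (\<lambda>n. G Mod \<Gamma> n))\<lparr>carrier := odometer G \<Gamma>\<rparr>"

definition odometer_topology ::
    "('a, 'm) monoid_scheme \<Rightarrow> (nat \<Rightarrow> 'a set) \<Rightarrow> (nat \<Rightarrow> 'a set) topology"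
  where "odometer_topology G \<Gamma> =
    subtopology (product_topology (\<lambda>n. discrete_topology (carrier (G Mod \<Gamma> n))) UNIV)
      (odometer G \<Gamma>)"

definition odometer_embedding ::
    "('a, 'm) monoid_scheme \<Rightarrow> (nat \<Rightarrow> 'a set) \<Rightarrow> 'a \<Rightarrow> nat \<Rightarrow> 'a set"
  where "odometer_embedding G \<Gamma> g = (\<lambda>n. g <#\<^bsub>G\<^esub> \<Gamma> n)"

text \<open>
  The translations are made extensional, so that the action takes values in
  \<^term>\<open>BijGroup (odometer G \<Gamma>)\<close>, as the locale \<^locale>\<open>group_action\<close> requires.
\<close>

definition odometer_action ::
    "('a, 'm) monoid_scheme \<Rightarrow> (nat \<Rightarrow> 'a set) \<Rightarrow> 'a \<Rightarrow> (nat \<Rightarrow> 'a set) \<Rightarrow> (nat \<Rightarrow> 'a set)"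
  where "odometer_action G \<Gamma> g =
    (\<lambda>x\<in>odometer G \<Gamma>. odometer_embedding G \<Gamma> g \<otimes>\<^bsub>odometer_group G \<Gamma>\<^esub> x)"

section \<open>Automorphism groups of dynamical systems\<close>

text \<open>
  A system consists of a topology \<open>T\<close>, a group \<open>G\<close> and an action \<open>\<alpha>\<close> of \<open>G\<close> on
  \<^term>\<open>topspace T\<close>. Homeomorphisms are taken to be extensional, so that each one is represented
  by exactly one HOL function; the group operation is the composition of \<^const>\<open>BijGroup\<close>.
\<close>

definition homeo_centralizer ::
    "'x topology \<Rightarrow> ('a \<Rightarrow> 'x \<Rightarrow> 'x) \<Rightarrow> ('a, 'm) monoid_scheme \<Rightarrow> ('x \<Rightarrow> 'x) set"
  where "homeo_centralizer T \<alpha> G =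
    {f \<in> Bij (topspace T). homeomorphic_map T T f \<and>
       (\<forall>g\<in>carrier G. \<forall>x\<in>topspace T. f (\<alpha> g x) = \<alpha> g (f x))}"

definition Aut_system ::
    "'x topology \<Rightarrow> ('a \<Rightarrow> 'x \<Rightarrow> 'x) \<Rightarrow> ('a, 'm) monoid_scheme \<Rightarrow> ('x \<Rightarrow> 'x) monoid"
  where "Aut_system T \<alpha> G = (BijGroup (topspace T))\<lparr>carrier := homeo_centralizer T \<alpha> G\<rparr>"

definition Aut_stabilized ::
    "'x topology \<Rightarrow> ('a \<Rightarrow> 'x \<Rightarrow> 'x) \<Rightarrow> ('a, 'm) monoid_scheme \<Rightarrow> ('x \<Rightarrow> 'x) monoid"
  where "Aut_stabilized T \<alpha> G =
    (BijGroup (topspace T))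
      \<lparr>carrier := (\<Union>K\<in>{K. finite_index_subgroup K G}. carrier (Aut_system T \<alpha> (G\<lparr>carrier := K\<rparr>)))\<rparr>"

section \<open>Continuous orbit equivalence\<close>

definition continuously_orbit_equivalent ::
    "'x topology \<Rightarrow> ('a \<Rightarrow> 'x \<Rightarrow> 'x) \<Rightarrow> ('a, 'm) monoid_scheme \<Rightarrow>
     'y topology \<Rightarrow> ('b \<Rightarrow> 'y \<Rightarrow> 'y) \<Rightarrow> ('b, 'k) monoid_scheme \<Rightarrow> bool"
  where "continuously_orbit_equivalent T \<alpha> G S \<beta> H \<longleftrightarrow>
    (\<exists>\<phi>. homeomorphic_map T S \<phi> \<and>
      bij_betw (\<lambda>A. \<phi> ` A) (orbits G (topspace T) \<alpha>) (orbits H (topspace S) \<beta>) \<and>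
      (\<forall>g\<in>carrier G. \<forall>x\<in>topspace T.
        \<exists>U h. openin T U \<and> closedin T U \<and> x \<in> U \<and> h \<in> carrier H \<and>
              (\<forall>y\<in>U. \<phi> (\<alpha> g y) = \<beta> h (\<phi> y))))"

section \<open>Consistency of the definitions\<close>

lemma group_scale_normal: "group_scale G \<Gamma> \<Longrightarrow> \<Gamma> n \<lhd> G"
  by (simp add: group_scale_def)

lemma bonding_coset:
  assumes "group_scale G \<Gamma>" and g: "g \<in> carrier G"
  shows "bonding G \<Gamma> n (\<Gamma> (Suc n) #>\<^bsub>G\<^esub> g) = \<Gamma> n #>\<^bsub>G\<^esub> g"
proof -
  interpret N: normal "\<Gamma> n" G using assms group_scale_normal by blast
  interpret M: normal "\<Gamma> (Suc n)" G using assms group_scale_normal by blast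
  have sub: "\<Gamma> (Suc n) \<subseteq> \<Gamma> n"
    using assms by (auto simp: group_scale_def decseq_Suc_iff)
  have "\<Gamma> n <#>\<^bsub>G\<^esub> \<Gamma> (Suc n) = \<Gamma> n"
  proof
    show "\<Gamma> n <#>\<^bsub>G\<^esub> \<Gamma> (Suc n) \<subseteq> \<Gamma> n"
      using sub by (auto simp: set_mult_def)
    show "\<Gamma> n \<subseteq> \<Gamma> n <#>\<^bsub>G\<^esub> \<Gamma> (Suc n)"
    proof
      fix a assume a: "a \<in> \<Gamma> n"
      then have "a = a \<otimes>\<^bsub>G\<^esub> \<one>\<^bsub>G\<^esub>" by simp
      then show "a \<in> \<Gamma> n <#>\<^bsub>G\<^esub> \<Gamma> (Suc n)"
        unfolding set_mult_def using a M.one_closed by blast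
    qed
  qed
  then show ?thesis
    unfolding bonding_def
    using N.setmult_rcos_assoc[OF N.subset M.subset g] by simp
qed

lemma topspace_odometer_topology [simp]:
  "topspace (odometer_topology G \<Gamma>) = odometer G \<Gamma>"
  by (auto simp: odometer_topology_def odometer_def)

lemma bonding_mult:
  assumes "group_scale G \<Gamma>" and "C \<in> carrier (G Mod \<Gamma> (Suc n))" "D \<in> carrier (G Mod \<Gamma> (Suc n))"
  shows "bonding G \<Gamma> n (C <#>\<^bsub>G\<^esub> D) = bonding G \<Gamma> n C <#>\<^bsub>G\<^esub> bonding G \<Gamma> n D"
proof -
  interpret N: normal "\<Gamma> n" G using assms group_scale_normal by blast
  interpret M: normal "\<Gamma> (Suc n)" G using assms group_scale_normal by blast
  obtain c d where "c \<in> carrier G" "d \<in> carrier G"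
    "C = \<Gamma> (Suc n) #>\<^bsub>G\<^esub> c" "D = \<Gamma> (Suc n) #>\<^bsub>G\<^esub> d"
    using assms by (auto simp: carrier_FactGroup)
  then show ?thesis
    using bonding_coset[OF assms(1)] by (simp add: M.rcos_sum N.rcos_sum)
qed

lemma odometer_subgroup:
  assumes "group_scale G \<Gamma>"
  shows "subgroup (odometer G \<Gamma>) (product_group UNIV (\<lambda>n. G Mod \<Gamma> n))"
proof -
  let ?P = "product_group UNIV (\<lambda>n. G Mod \<Gamma> n)"
  have Q: "group (G Mod \<Gamma> n)" for n
    using assms group_scale_normal normal.factorgroup_is_group by blast
  interpret P: group ?P using Q by simp
  interpret G: group G using assms group_scale_normal normal.axioms(2) by blast
  show ?thesis
  proof (rule P.subgroupI)
    show "odometer G \<Gamma> \<subseteq> carrier ?P" by (auto simp: odometer_def)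
    have "\<one>\<^bsub>?P\<^esub> \<in> odometer G \<Gamma>"
    proof -
      have "bonding G \<Gamma> n (\<Gamma> (Suc n)) = \<Gamma> n" for n
        using bonding_coset[OF assms, of "\<one>\<^bsub>G\<^esub>" n] group_scale_normal[OF assms]
        by (metis G.one_closed G.coset_mult_one normal_imp_subgroup subgroup.subset)
      then show ?thesis using P.one_closed by (simp add: odometer_def)
    qed
    then show "odometer G \<Gamma> \<noteq> {}" by auto
  next
    fix x assume x: "x \<in> odometer G \<Gamma>"
    then have xP: "x \<in> carrier ?P" by (simp add: odometer_def)
    have "bonding G \<Gamma> n ((inv\<^bsub>?P\<^esub> x) (Suc n)) = (inv\<^bsub>?P\<^esub> x) n" for n
    proof -
      interpret N: normal "\<Gamma> n" G using assms group_scale_normal by blast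
      interpret M: normal "\<Gamma> (Suc n)" G using assms group_scale_normal by blast
      obtain c where c: "c \<in> carrier G" "x (Suc n) = \<Gamma> (Suc n) #>\<^bsub>G\<^esub> c"
        using xP by (auto simp: carrier_FactGroup PiE_iff)
      have "bonding G \<Gamma> n (x (Suc n)) = x n"
        using x by (simp add: odometer_def)
      then have xn: "x n = \<Gamma> n #>\<^bsub>G\<^esub> c"
        using bonding_coset[OF assms c(1), of n] c(2) by metis
      have inv: "inv\<^bsub>G Mod \<Gamma> m\<^esub> (\<Gamma> m #>\<^bsub>G\<^esub> c) = \<Gamma> m #>\<^bsub>G\<^esub> inv\<^bsub>G\<^esub> c" for m
      proof -
        interpret K: normal "\<Gamma> m" G using assms group_scale_normal by blast
        have "\<Gamma> m #>\<^bsub>G\<^esub> c \<in> carrier (G Mod \<Gamma> m)" using c by (auto simp: carrier_FactGroup)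
        then show ?thesis using K.inv_FactGroup K.rcos_inv[OF c(1)] by metis
      qed
      have "(inv\<^bsub>?P\<^esub> x) m = inv\<^bsub>G Mod \<Gamma> m\<^esub> (x m)" for m
        using xP Q by simp
      then show ?thesis
        using bonding_coset[OF assms G.inv_closed[OF c(1)], of n] inv xn c(2) by metis
    qed
    then show "inv\<^bsub>?P\<^esub> x \<in> odometer G \<Gamma>"
      using P.inv_closed[OF xP] by (simp add: odometer_def)
  next
    fix x y assume x: "x \<in> odometer G \<Gamma>" and y: "y \<in> odometer G \<Gamma>"
    then have xP: "x \<in> carrier ?P" "y \<in> carrier ?P" by (simp_all add: odometer_def)
    have "bonding G \<Gamma> n ((x \<otimes>\<^bsub>?P\<^esub> y) (Suc n)) = (x \<otimes>\<^bsub>?P\<^esub> y) n" for n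
      using x y xP bonding_mult[OF assms, of "x (Suc n)" n "y (Suc n)"]
      by (simp add: odometer_def PiE_iff)
    then show "x \<otimes>\<^bsub>?P\<^esub> y \<in> odometer G \<Gamma>"
      using P.m_closed[OF xP] by (simp add: odometer_def)
  qed
qed

lemma group_odometer_group: "group_scale G \<Gamma> \<Longrightarrow> group (odometer_group G \<Gamma>)"
  unfolding odometer_group_def
  by (intro subgroup.subgroup_is_group odometer_subgroup)
     (simp_all add: normal.factorgroup_is_group group_scale_def)

lemma odometer_embedding_hom:
  assumes "group_scale G \<Gamma>"
  shows "odometer_embedding G \<Gamma> \<in> hom G (odometer_group G \<Gamma>)"
proof -
  have e: "odometer_embedding G \<Gamma> g n = \<Gamma> n #>\<^bsub>G\<^esub> g" if "g \<in> carrier G" for g n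
    using that normal.coset_eq[OF group_scale_normal[OF assms]]
    by (simp add: odometer_embedding_def)
  interpret G: group G using assms group_scale_normal normal.axioms(2) by blast
  show ?thesis
  proof (rule homI)
    fix g assume g: "g \<in> carrier G"
    then show "odometer_embedding G \<Gamma> g \<in> carrier (odometer_group G \<Gamma>)"
      by (auto simp: odometer_group_def odometer_def e carrier_FactGroup bonding_coset[OF assms])
  next
    fix g h assume "g \<in> carrier G" "h \<in> carrier G"
    then show "odometer_embedding G \<Gamma> (g \<otimes>\<^bsub>G\<^esub> h) =
      odometer_embedding G \<Gamma> g \<otimes>\<^bsub>odometer_group G \<Gamma>\<^esub> odometer_embedding G \<Gamma> h"
      by (auto simp: odometer_group_def e normal.rcos_sum[OF group_scale_normal[OF assms]])
  qed
qed

lemma group_action_odometer: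
  assumes "group_scale G \<Gamma>"
  shows "group_action G (odometer G \<Gamma>) (odometer_action G \<Gamma>)"
proof -
  interpret G: group G using assms group_scale_normal normal.axioms(2) by blast
  interpret X: group "odometer_group G \<Gamma>" using assms by (rule group_odometer_group)
  interpret h: group_hom G "odometer_group G \<Gamma>" "odometer_embedding G \<Gamma>"
    using odometer_embedding_hom[OF assms] by unfold_locales
  have c: "carrier (odometer_group G \<Gamma>) = odometer G \<Gamma>" by (simp add: odometer_group_def)
  have B: "odometer_action G \<Gamma> g \<in> Bij (odometer G \<Gamma>)" if g: "g \<in> carrier G" for g
  proof -
    have "bij_betw (odometer_action G \<Gamma> g) (odometer G \<Gamma>) (odometer G \<Gamma>)"
      by (rule bij_betw_byWitness[where
            f' = "\<lambda>x. inv\<^bsub>odometer_group G \<Gamma>\<^esub> odometer_embedding G \<Gamma> g \<otimes>\<^bsub>odometer_group G \<Gamma>\<^esub> x"])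
         (use h.hom_closed[OF g] X.m_closed X.inv_closed X.m_assoc[symmetric] in
           \<open>auto simp: odometer_action_def c\<close>)
    then show ?thesis by (simp add: Bij_def odometer_action_def)
  qed
  have "odometer_action G \<Gamma> \<in> hom G (BijGroup (odometer G \<Gamma>))"
  proof (rule homI)
    fix g assume "g \<in> carrier G"
    then show "odometer_action G \<Gamma> g \<in> carrier (BijGroup (odometer G \<Gamma>))"
      by (simp add: BijGroup_def B)
  next
    fix g h assume "g \<in> carrier G" "h \<in> carrier G"
    then show "odometer_action G \<Gamma> (g \<otimes>\<^bsub>G\<^esub> h) =
        odometer_action G \<Gamma> g \<otimes>\<^bsub>BijGroup (odometer G \<Gamma>)\<^esub> odometer_action G \<Gamma> h"
      using B h.hom_closed X.m_closed X.m_assoc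
      by (auto simp: BijGroup_def compose_def odometer_action_def c restrict_def fun_eq_iff)
  qed
  then show ?thesis
    by (simp add: group_action_def group_hom_def group_hom_axioms_def group_BijGroup G.group_axioms)
qed

end

theory Submission
  imports Defs "HOL-Analysis.Abstract_Topological_Spaces" "HOL-Library.Nat_Bijection"
    "HOL-Library.Product_Plus" "HOL-Number_Theory.Cong"
begin

text \<open>
  Write \<open>U\<^sub>n\<close> for the open subgroup of all \<open>u\<close> with \<open>u n = \<Gamma> n\<close>. A homeomorphism of the odometer \<open>X\<close>
  lies in the stabilized automorphism group iff it commutes with left multiplication by some \<open>U\<^sub>n\<close>,
  because the left multiplications it commutes with form a closed subgroup of finite index.
  Hence the group is preserved under conjugation by a homeomorphism \<open>\<psi> : X \<rightarrow> Y\<close> with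
  \<open>\<psi> (u x) = \<psi> u \<cdot> \<psi> x\<close> for \<open>u \<in> U\<^sub>n\<close>.

  Given a continuous orbit equivalence \<open>\<phi>\<close> with \<open>\<phi> 1 = 1\<close>, compactness and finite generation make its
  cocycle invariant under some \<open>U\<^sub>N\<close>; by density \<open>\<phi> (x u) = \<phi> x \<cdot> \<phi> u\<close> for \<open>u \<in> U\<^sub>N\<close>,
  so \<open>\<psi> x = (\<phi> (x\<inverse>))\<inverse>\<close> is as required.

  For the failure of the converse take \<open>G = \<int>\<^sup>2\<close> with \<open>\<Gamma> n = 2\<^sup>n\<int> \<times> 3\<^sup>n\<int>\<close> and let \<open>H\<close> be the diagonal,
  with the induced scale. By the Chinese remainder theorem \<open>H\<close> is dense, so both odometers are the
  same topological group, but an orbit equivalence would embed a subgroup isomorphic to \<open>\<int>\<^sup>2\<close>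
  into \<open>H \<cong> \<int>\<close>.
\<close>

section \<open>Topology of an odometer\<close>

locale odometer_space =
  fixes G :: "('a, 'm) monoid_scheme" and \<Gamma> :: "nat \<Rightarrow> 'a set"
  assumes scale: "group_scale G \<Gamma>"
begin

abbreviation odo_grp where "odo_grp \<equiv> odometer_group G \<Gamma>"

lemma normal_scale: "\<Gamma> n \<lhd> G"
  using scale by (rule group_scale_normal)

sublocale G: group G
  using normal_scale normal.axioms(2) by blast

sublocale X: group odo_grp
  using scale by (rule group_odometer_group)

lemma carrier_X [simp]: "carrier odo_grp = odometer G \<Gamma>"
  by (simp add: odometer_group_def)

lemmas X_closed [simp] = X.m_closed[simplified] X.inv_closed[simplified] X.one_closed[simplified]

lemma mult_at: "(x \<otimes>\<^bsub>odo_grp\<^esub> y) n = x n <#>\<^bsub>G\<^esub> y n"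
  by (simp add: odometer_group_def)

lemma one_at [simp]: "\<one>\<^bsub>odo_grp\<^esub> n = \<Gamma> n"
  by (simp add: odometer_group_def)

lemma mult_cong_at: "\<lbrakk>x n = x' n; y n = y' n\<rbrakk> \<Longrightarrow> (x \<otimes>\<^bsub>odo_grp\<^esub> y) n = (x' \<otimes>\<^bsub>odo_grp\<^esub> y') n"
  by (simp add: mult_at)

text \<open>Multiplication is coordinatewise, so at coordinate \<open>n\<close> the factor
  \<open>y\<close> in \<open>y\<close> times its inverse may be exchanged for \<open>x\<close>; no
  inverse has to be computed in the quotient groups.\<close>

lemma inv_cong_at:
  assumes "x \<in> odometer G \<Gamma>" "y \<in> odometer G \<Gamma>" and "x n = y n"
  shows "(inv\<^bsub>odo_grp\<^esub> x) n = (inv\<^bsub>odo_grp\<^esub> y) n"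
proof -
  have "(inv\<^bsub>odo_grp\<^esub> x) n = (inv\<^bsub>odo_grp\<^esub> x \<otimes>\<^bsub>odo_grp\<^esub> (y \<otimes>\<^bsub>odo_grp\<^esub> inv\<^bsub>odo_grp\<^esub> y)) n"
    using assms by (simp add: X.r_inv)
  also have "\<dots> = (inv\<^bsub>odo_grp\<^esub> x \<otimes>\<^bsub>odo_grp\<^esub> (x \<otimes>\<^bsub>odo_grp\<^esub> inv\<^bsub>odo_grp\<^esub> y)) n"
    using assms(3) by (intro mult_cong_at) auto
  also have "\<dots> = (inv\<^bsub>odo_grp\<^esub> y) n"
    using assms by (simp flip: X.m_assoc)
  finally show ?thesis .
qed

abbreviation \<tau> where "\<tau> \<equiv> odometer_embedding G \<Gamma>"

sublocale \<tau>: group_hom G odo_grp \<tau>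
  using odometer_embedding_hom[OF scale] by unfold_locales

lemma embedding_at: "g \<in> carrier G \<Longrightarrow> \<tau> g n = \<Gamma> n #>\<^bsub>G\<^esub> g"
  using normal.coset_eq[OF normal_scale] by (simp add: odometer_embedding_def)

lemma embedding_in [simp]: "g \<in> carrier G \<Longrightarrow> \<tau> g \<in> odometer G \<Gamma>"
  using \<tau>.hom_closed by simp

lemma embedding_one_at_iff:
  assumes "g \<in> carrier G" shows "\<tau> g n = \<Gamma> n \<longleftrightarrow> g \<in> \<Gamma> n"
proof -
  interpret N: normal "\<Gamma> n" G by (rule normal_scale)
  show ?thesis
    using G.coset_join1[OF _ assms N.subgroup_axioms] G.coset_join2[OF assms N.subgroup_axioms]
    by (auto simp: embedding_at[OF assms])
qed

lemma embedding_inj: "inj_on \<tau> (carrier G)"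
proof (subst \<tau>.inj_on_one_iff, intro allI impI)
  fix g assume g: "g \<in> carrier G" and "\<tau> g = \<one>\<^bsub>odo_grp\<^esub>"
  then have "g \<in> (\<Inter>n. \<Gamma> n)"
    using embedding_one_at_iff[OF g] by simp
  then show "g = \<one>\<^bsub>G\<^esub>"
    using scale unfolding group_scale_def by blast
qed

text \<open>Downward induction from \<open>n\<close>: each bonding map sends the coset of
  \<open>g\<close> one level down to the coset of \<open>g\<close>.\<close>

lemma coset_at_le:
  assumes x: "x \<in> odometer G \<Gamma>" and g: "g \<in> carrier G" and "x n = \<tau> g n" and "k \<le> n"
  shows "x k = \<tau> g k"
  using \<open>k \<le> n\<close> \<open>x n = \<tau> g n\<close>
proof (induction k rule: inc_induct)
  case (step k)
  then have "x (Suc k) = \<Gamma> (Suc k) #>\<^bsub>G\<^esub> g" by (simp add: embedding_at g)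
  moreover have "x k = bonding G \<Gamma> k (x (Suc k))" using x by (simp add: odometer_def)
  ultimately show ?case using bonding_coset[OF scale g] by (simp add: embedding_at g)
qed

lemma embedding_dense:
  assumes "x \<in> odometer G \<Gamma>"
  obtains g where "g \<in> carrier G" and "\<tau> g n = x n"
proof -
  have "x n \<in> carrier (G Mod \<Gamma> n)" using assms by (auto simp: odometer_def PiE_iff)
  then show thesis using that by (auto simp: carrier_FactGroup embedding_at)
qed

text \<open>A coordinate determines all lower ones. This allows several levels to be replaced by
  their maximum in what follows.\<close>

lemma eq_at_le:
  assumes "x \<in> odometer G \<Gamma>" "y \<in> odometer G \<Gamma>" and "x n = y n" and "k \<le> n"
  shows "x k = y k"
  by (metis assms coset_at_le embedding_dense)

abbreviation T where "T \<equiv> odometer_topology G \<Gamma>"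

text \<open>A basic open set of the product restricts finitely many coordinates. By
  \<open>eq_at_le\<close>, fixing a single coordinate beyond all of them already confines a point to
  it.\<close>

lemma openin_odometer_iff:
  "openin T A \<longleftrightarrow>
    A \<subseteq> odometer G \<Gamma> \<and> (\<forall>x\<in>A. \<exists>n. \<forall>y\<in>odometer G \<Gamma>. y n = x n \<longrightarrow> y \<in> A)"
proof
  let ?P = "product_topology (\<lambda>n. discrete_topology (carrier (G Mod \<Gamma> n))) UNIV"
  assume L: "openin T A"
  then obtain B where B: "openin ?P B" "A = B \<inter> odometer G \<Gamma>"
    by (auto simp: odometer_topology_def openin_subtopology)
  show "A \<subseteq> odometer G \<Gamma> \<and> (\<forall>x\<in>A. \<exists>n. \<forall>y\<in>odometer G \<Gamma>. y n = x n \<longrightarrow> y \<in> A)"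
  proof (intro conjI ballI)
    show "A \<subseteq> odometer G \<Gamma>" using B by blast
    fix x assume x: "x \<in> A"
    then obtain U where U: "finite {i. U i \<noteq> carrier (G Mod \<Gamma> i)}"
      "x \<in> Pi\<^sub>E UNIV U" "Pi\<^sub>E UNIV U \<subseteq> B"
      using B by (auto simp: openin_product_topology_alt)
    obtain n where n: "\<And>i. U i \<noteq> carrier (G Mod \<Gamma> i) \<Longrightarrow> i \<le> n"
      using U(1) by (auto simp: finite_nat_set_iff_bounded_le)
    show "\<exists>n. \<forall>y\<in>odometer G \<Gamma>. y n = x n \<longrightarrow> y \<in> A"
    proof (intro exI ballI impI)
      fix y assume y: "y \<in> odometer G \<Gamma>" "y n = x n"
      have "y i \<in> U i" for i
      proof (cases "U i = carrier (G Mod \<Gamma> i)")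
        case True then show ?thesis using y by (auto simp: odometer_def PiE_iff)
      next
        case False
        then have "y i = x i" using eq_at_le[of y x n i] y x B n[of i] by auto
        then show ?thesis using U(2) by (auto simp: PiE_iff)
      qed
      then show "y \<in> A" using U(3) B(2) y by auto
    qed
  qed
next
  let ?P = "product_topology (\<lambda>n. discrete_topology (carrier (G Mod \<Gamma> n))) UNIV"
  assume R: "A \<subseteq> odometer G \<Gamma> \<and> (\<forall>x\<in>A. \<exists>n. \<forall>y\<in>odometer G \<Gamma>. y n = x n \<longrightarrow> y \<in> A)"
  show "openin T A"
  proof (subst openin_subopen, intro ballI)
    fix x assume x: "x \<in> A"
    with R obtain n where n: "\<And>y. y \<in> odometer G \<Gamma> \<Longrightarrow> y n = x n \<Longrightarrow> y \<in> A" by blast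
    have "openin T {y \<in> topspace T. y n \<in> {x n}}"
    proof (rule openin_continuous_map_preimage)
      show "continuous_map T (discrete_topology (carrier (G Mod \<Gamma> n))) (\<lambda>y. y n)"
        unfolding odometer_topology_def
        by (intro continuous_map_from_subtopology continuous_map_product_projection) simp
      show "openin (discrete_topology (carrier (G Mod \<Gamma> n))) {x n}"
        using R x by (auto simp: odometer_def PiE_iff)
    qed
    then show "\<exists>S. openin T S \<and> x \<in> S \<and> S \<subseteq> A"
      using n x R by (intro exI[of _ "{y \<in> topspace T. y n \<in> {x n}}"]) auto
  qed
qed

lemma openin_level:
  "x \<in> odometer G \<Gamma> \<Longrightarrow> openin T {y \<in> odometer G \<Gamma>. y n = x n}"
  by (auto simp: openin_odometer_iff)

text \<open>The quotients are finite, so the product is compact by Tychonoff. The odometer is closed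
  in it, being cut out by equations between continuous maps into a discrete, hence Hausdorff,
  space.\<close>

lemma compact_odometer: "compact_space T"
proof -
  let ?P = "product_topology (\<lambda>n. discrete_topology (carrier (G Mod \<Gamma> n))) UNIV"
  have P: "compact_space ?P"
    using scale
    by (simp add: compact_space_product_topology compact_space_discrete_topology FactGroup_def
        group_scale_def finite_index_subgroup_def)
  have "closedin ?P {x \<in> topspace ?P. bonding G \<Gamma> n (x (Suc n)) = x n}" for n
  proof -
    have c: "continuous_map ?P (discrete_topology UNIV) (\<lambda>x. f (x k))" for k and f :: "'a set \<Rightarrow> 'a set"
    proof (rule continuous_map_compose[where g = f, unfolded comp_def])
      show "continuous_map ?P (discrete_topology (carrier (G Mod \<Gamma> k))) (\<lambda>x. x k)"
        by (intro continuous_map_product_projection) simp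
      show "continuous_map (discrete_topology (carrier (G Mod \<Gamma> k))) (discrete_topology UNIV) f"
        by simp
    qed
    show ?thesis
      using closedin_continuous_maps_eq[OF Hausdorff_space_discrete_topology
          c[of "bonding G \<Gamma> n" "Suc n"] c[of "\<lambda>C. C" n]] by simp
  qed
  then have "closedin ?P (\<Inter>n. {x \<in> topspace ?P. bonding G \<Gamma> n (x (Suc n)) = x n})"
    by (intro closedin_INT) auto
  moreover have "(\<Inter>n. {x \<in> topspace ?P. bonding G \<Gamma> n (x (Suc n)) = x n}) = odometer G \<Gamma>"
    by (auto simp: odometer_def)
  ultimately have "compactin ?P (odometer G \<Gamma>)"
    using P closedin_compact_space by metis
  then show ?thesis
    by (simp add: odometer_topology_def compact_space_subtopology)
qed

end

section \<open>The stabilized automorphism group\<close>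

context odometer_space begin

lemma action_eq: "x \<in> odometer G \<Gamma> \<Longrightarrow> odometer_action G \<Gamma> g x = \<tau> g \<otimes>\<^bsub>odo_grp\<^esub> x"
  by (simp add: odometer_action_def)

text \<open>Let \<open>R\<close> represent the finitely many cosets of \<open>K\<close>. Since
  \<open>S\<close> is closed, each \<open>\<tau> r\<close> outside \<open>S\<close> is separated
  from \<open>S\<close> at some level; let \<open>N\<close> bound these levels. If
  \<open>g = k r\<close> is trivial at level \<open>N\<close>, then \<open>\<tau> r\<close> agrees
  there with the inverse of \<open>\<tau> k\<close>, an element of \<open>S\<close>, so
  \<open>\<tau> r\<close> and hence \<open>\<tau> g\<close> lie in \<open>S\<close>. Density and
  closedness pass from such \<open>g\<close> to all of \<open>U\<^sub>N\<close>.\<close>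

lemma closed_finite_index_open:
  assumes S: "subgroup S odo_grp"
    and closed: "\<And>x. \<lbrakk>x \<in> odometer G \<Gamma>; \<And>n. \<exists>s\<in>S. s n = x n\<rbrakk> \<Longrightarrow> x \<in> S"
    and K: "finite_index_subgroup K G" and KS: "\<tau> ` K \<subseteq> S"
  shows "\<exists>n. \<forall>u\<in>odometer G \<Gamma>. u n = \<Gamma> n \<longrightarrow> u \<in> S"
proof -
  interpret S: subgroup S odo_grp by (rule S)
  interpret K: subgroup K G using K by (simp add: finite_index_subgroup_def)
  have SX: "s \<in> odometer G \<Gamma>" if "s \<in> S" for s using that S.subset by auto
  have KG: "k \<in> carrier G" if "k \<in> K" for k using that K.subset by auto
  have fin: "finite (rcosets\<^bsub>G\<^esub> K)" using K by (simp add: finite_index_subgroup_def)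
  obtain R where R: "finite R" "R \<subseteq> carrier G" "rcosets\<^bsub>G\<^esub> K = (\<lambda>r. K #>\<^bsub>G\<^esub> r) ` R"
    using finite_subset_image[OF fin, of "\<lambda>r. K #>\<^bsub>G\<^esub> r" "carrier G"]
    unfolding RCOSETS_def by blast
  have "\<exists>n. \<forall>s\<in>S. s n \<noteq> \<tau> r n" if "r \<in> R" "\<tau> r \<notin> S" for r
    using closed[OF embedding_in, of r] that R(2) by blast
  then obtain n where n: "\<And>r s. \<lbrakk>r \<in> R; \<tau> r \<notin> S; s \<in> S\<rbrakk> \<Longrightarrow> s (n r) \<noteq> \<tau> r (n r)"
    by metis
  obtain N where N: "\<And>r. r \<in> R \<Longrightarrow> n r \<le> N"
    using finite_imageI[OF R(1), of n] by (auto simp: finite_nat_set_iff_bounded_le)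
  show ?thesis
  proof (intro exI ballI impI)
    fix u assume u: "u \<in> odometer G \<Gamma>" "u N = \<Gamma> N"
    show "u \<in> S"
    proof (rule closed[OF u(1)])
      fix m
      \<comment> \<open>The level \<open>max m N\<close> serves two ends: \<open>\<tau> g\<close>
        approximates \<open>u\<close> at \<open>m\<close> and is trivial at
        \<open>N\<close>.\<close>
      obtain g where g: "g \<in> carrier G" "\<tau> g (max m N) = u (max m N)"
        using embedding_dense u(1) by blast
      have gm: "\<tau> g m = u m" and "\<tau> g N = u N"
        using g u eq_at_le[of "\<tau> g" u "max m N" m] eq_at_le[of "\<tau> g" u "max m N" N] by auto
      then have gN: "\<tau> g N = \<Gamma> N" using u(2) by simp
      have "K #>\<^bsub>G\<^esub> g \<in> (\<lambda>r. K #>\<^bsub>G\<^esub> r) ` R"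
        using R(3) g(1) by (auto simp: RCOSETS_def)
      then obtain r where r: "r \<in> R" "K #>\<^bsub>G\<^esub> g = K #>\<^bsub>G\<^esub> r" by blast
      then have rG: "r \<in> carrier G" using R(2) by blast
      have "g \<in> K #>\<^bsub>G\<^esub> r" using r(2) G.rcos_self[OF g(1) K.subgroup_axioms] by simp
      then obtain k where k: "k \<in> K" "g = k \<otimes>\<^bsub>G\<^esub> r" by (auto simp: r_coset_def)
      have kG: "k \<in> carrier G" using k KG by blast
      have "\<tau> r = inv\<^bsub>odo_grp\<^esub> \<tau> k \<otimes>\<^bsub>odo_grp\<^esub> \<tau> g"
        using kG rG k(2) by (simp add: X.inv_solve_left)
      then have "\<tau> r N = (inv\<^bsub>odo_grp\<^esub> \<tau> k \<otimes>\<^bsub>odo_grp\<^esub> \<one>\<^bsub>odo_grp\<^esub>) N"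
        using gN by (simp add: mult_at)
      then have *: "\<tau> r N = (inv\<^bsub>odo_grp\<^esub> \<tau> k) N" using kG by simp
      have kS: "inv\<^bsub>odo_grp\<^esub> \<tau> k \<in> S" "\<tau> k \<in> S" using k(1) KS by auto
      have "\<tau> r \<in> S"
      proof (rule ccontr)
        assume "\<tau> r \<notin> S"
        moreover have "(inv\<^bsub>odo_grp\<^esub> \<tau> k) (n r) = \<tau> r (n r)"
          using eq_at_le[of "inv\<^bsub>odo_grp\<^esub> \<tau> k" "\<tau> r" N "n r"] * N[OF r(1)] kG rG by simp
        ultimately show False using n r(1) kS by blast
      qed
      then have "\<tau> g \<in> S" using kS k kG rG by simp
      then show "\<exists>s\<in>S. s m = u m" using gm by blast
    qed
  qed
qed

end

section \<open>Continuous maps between two odometers\<close>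

locale odometer_pair = A: odometer_space G \<Gamma> + B: odometer_space H \<Delta>
  for G :: "('a, 'm) monoid_scheme" and \<Gamma> and H :: "('b, 'k) monoid_scheme" and \<Delta>
begin

text \<open>By \<open>openin_odometer_iff\<close> the points sharing one coordinate with
  \<open>x\<close> form a neighbourhood base at \<open>x\<close>, so continuity becomes an
  epsilon-delta condition on coordinates.\<close>

lemma continuous_map_iff:
  "continuous_map A.T B.T f \<longleftrightarrow> f \<in> odometer G \<Gamma> \<rightarrow> odometer H \<Delta> \<and>
    (\<forall>x\<in>odometer G \<Gamma>. \<forall>n. \<exists>k. \<forall>y\<in>odometer G \<Gamma>. y k = x k \<longrightarrow> f y n = f x n)"
proof (intro iffI conjI ballI allI)
  assume f: "continuous_map A.T B.T f"
  then show fX: "f \<in> odometer G \<Gamma> \<rightarrow> odometer H \<Delta>"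
    using continuous_map_funspace[OF f] by simp
  fix x n assume x: "x \<in> odometer G \<Gamma>"
  then have "openin A.T {z \<in> topspace A.T. f z \<in> {y \<in> odometer H \<Delta>. y n = f x n}}"
    using f fX by (intro openin_continuous_map_preimage[OF f] B.openin_level) auto
  then have "\<exists>k. \<forall>y\<in>odometer G \<Gamma>. y k = x k \<longrightarrow>
      y \<in> {z \<in> topspace A.T. f z \<in> {y \<in> odometer H \<Delta>. y n = f x n}}"
    using x fX unfolding A.openin_odometer_iff by (auto simp: Pi_iff)
  then show "\<exists>k. \<forall>y\<in>odometer G \<Gamma>. y k = x k \<longrightarrow> f y n = f x n"
    by auto
next
  assume f: "f \<in> odometer G \<Gamma> \<rightarrow> odometer H \<Delta> \<and>
    (\<forall>x\<in>odometer G \<Gamma>. \<forall>n. \<exists>k. \<forall>y\<in>odometer G \<Gamma>. y k = x k \<longrightarrow> f y n = f x n)"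
  then have fX: "f \<in> odometer G \<Gamma> \<rightarrow> odometer H \<Delta>" by blast
  have "openin A.T {x \<in> odometer G \<Gamma>. f x \<in> V}" if V: "openin B.T V" for V
    unfolding A.openin_odometer_iff
  proof (intro conjI ballI)
    fix x assume "x \<in> {x \<in> odometer G \<Gamma>. f x \<in> V}"
    then have x: "x \<in> odometer G \<Gamma>" "f x \<in> V" by auto
    then obtain n where n: "\<And>y. y \<in> odometer H \<Delta> \<Longrightarrow> y n = f x n \<Longrightarrow> y \<in> V"
      using V unfolding B.openin_odometer_iff by blast
    obtain k where "\<forall>y\<in>odometer G \<Gamma>. y k = x k \<longrightarrow> f y n = f x n"
      using f x(1) by blast
    then have "y \<in> {x \<in> odometer G \<Gamma>. f x \<in> V}" if "y \<in> odometer G \<Gamma>" "y k = x k" for y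
      using that n[of "f y"] fX by auto
    then show "\<exists>n. \<forall>y\<in>odometer G \<Gamma>. y n = x n \<longrightarrow> y \<in> {x \<in> odometer G \<Gamma>. f x \<in> V}"
      by blast
  qed auto
  then show "continuous_map A.T B.T f"
    using f by (simp add: continuous_map_def)
qed

lemma continuous_atE:
  assumes "continuous_map A.T B.T f" and "x \<in> odometer G \<Gamma>"
  obtains k where "\<And>y. \<lbrakk>y \<in> odometer G \<Gamma>; y k = x k\<rbrakk> \<Longrightarrow> f y n = f x n"
proof -
  have "\<exists>k. \<forall>y\<in>odometer G \<Gamma>. y k = x k \<longrightarrow> f y n = f x n"
    using assms by (auto simp: continuous_map_iff)
  then show thesis using that by auto
qed

end

section \<open>Stabilized automorphisms described by open subgroups\<close>

context odometer_space begin

sublocale self: odometer_pair G \<Gamma> G \<Gamma> ..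

text \<open>Commutation is with the whole open subgroup \<open>U\<^sub>n\<close>, without reference
  to subgroups of \<open>G\<close>. This intrinsic form can be carried over to another
  odometer.\<close>

definition commutes_at :: "nat \<Rightarrow> ((nat \<Rightarrow> 'a set) \<Rightarrow> nat \<Rightarrow> 'a set) \<Rightarrow> bool"
  where "commutes_at n F \<longleftrightarrow>
    (\<forall>u\<in>odometer G \<Gamma>. u n = \<Gamma> n \<longrightarrow>
      (\<forall>x\<in>odometer G \<Gamma>. F (u \<otimes>\<^bsub>odo_grp\<^esub> x) = u \<otimes>\<^bsub>odo_grp\<^esub> F x))"

abbreviation Aut_inf where "Aut_inf \<equiv> Aut_stabilized T (odometer_action G \<Gamma>) G"

lemma commutes_at_if_commutes:
  assumes F: "continuous_map T T F" and K: "finite_index_subgroup K G"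
    and comm: "\<And>g x. \<lbrakk>g \<in> K; x \<in> odometer G \<Gamma>\<rbrakk> \<Longrightarrow> F (\<tau> g \<otimes>\<^bsub>odo_grp\<^esub> x) = \<tau> g \<otimes>\<^bsub>odo_grp\<^esub> F x"
  shows "\<exists>n. commutes_at n F"
proof -
  let ?S = "{u \<in> odometer G \<Gamma>. \<forall>x\<in>odometer G \<Gamma>. F (u \<otimes>\<^bsub>odo_grp\<^esub> x) = u \<otimes>\<^bsub>odo_grp\<^esub> F x}"
  have FX: "F x \<in> odometer G \<Gamma>" if "x \<in> odometer G \<Gamma>" for x
    using F that by (auto simp: self.continuous_map_iff)
  have S: "subgroup ?S odo_grp"
  proof (rule X.subgroupI)
    show "?S \<noteq> {}" using FX by (auto intro!: exI[of _ "\<one>\<^bsub>odo_grp\<^esub>"])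
  next
    fix u assume u: "u \<in> ?S"
    have "F (inv\<^bsub>odo_grp\<^esub> u \<otimes>\<^bsub>odo_grp\<^esub> x) = inv\<^bsub>odo_grp\<^esub> u \<otimes>\<^bsub>odo_grp\<^esub> F x" if x: "x \<in> odometer G \<Gamma>" for x
    proof -
      have "F x = F (u \<otimes>\<^bsub>odo_grp\<^esub> (inv\<^bsub>odo_grp\<^esub> u \<otimes>\<^bsub>odo_grp\<^esub> x))"
        using u x by (simp flip: X.m_assoc)
      also have "\<dots> = u \<otimes>\<^bsub>odo_grp\<^esub> F (inv\<^bsub>odo_grp\<^esub> u \<otimes>\<^bsub>odo_grp\<^esub> x)" using u x by simp
      finally show ?thesis using u x FX by (simp add: X.inv_solve_left)
    qed
    then show "inv\<^bsub>odo_grp\<^esub> u \<in> ?S" using u by simp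
  next
    fix u v assume "u \<in> ?S" "v \<in> ?S"
    then show "u \<otimes>\<^bsub>odo_grp\<^esub> v \<in> ?S" using FX by (simp add: X.m_assoc)
  qed auto
  have closed: "u \<in> ?S" if u: "u \<in> odometer G \<Gamma>" and lim: "\<And>n. \<exists>s\<in>?S. s n = u n" for u
  proof -
    have "F (u \<otimes>\<^bsub>odo_grp\<^esub> x) m = (u \<otimes>\<^bsub>odo_grp\<^esub> F x) m" if x: "x \<in> odometer G \<Gamma>" for x m
    proof -
      \<comment> \<open>Continuity at the product of \<open>u\<close> and \<open>x\<close> gives the
        level \<open>k\<close> that controls coordinate \<open>m\<close>. An element of
        \<open>?S\<close> agreeing with \<open>u\<close> at both \<open>k\<close> and
        \<open>m\<close> then transfers the identity to \<open>u\<close>.\<close>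
      obtain k where k: "\<And>y. \<lbrakk>y \<in> odometer G \<Gamma>; y k = (u \<otimes>\<^bsub>odo_grp\<^esub> x) k\<rbrakk> \<Longrightarrow> F y m = F (u \<otimes>\<^bsub>odo_grp\<^esub> x) m"
        using self.continuous_atE[OF F, of "u \<otimes>\<^bsub>odo_grp\<^esub> x"] u x by auto
      obtain s where s: "s \<in> ?S" "s (max k m) = u (max k m)" using lim by blast
      then have "s k = u k" "s m = u m"
        using s(1) u eq_at_le[of s u "max k m" k] eq_at_le[of s u "max k m" m] by auto
      then show ?thesis using k[of "s \<otimes>\<^bsub>odo_grp\<^esub> x"] s(1) x by (simp add: mult_at)
    qed
    then show ?thesis using u by (simp add: fun_eq_iff)
  qed
  have KS: "\<tau> ` K \<subseteq> ?S"
    using comm embedding_in subgroup.subset[of K G] K unfolding finite_index_subgroup_def by blast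
  have "\<exists>n. \<forall>u\<in>odometer G \<Gamma>. u n = \<Gamma> n \<longrightarrow> u \<in> ?S"
    by (rule closed_finite_index_open[OF S closed K KS])
  then show ?thesis by (simp add: commutes_at_def)
qed

text \<open>One inclusion is \<open>commutes_at_if_commutes\<close>. For the other,
  \<open>\<Gamma> n\<close> itself is a finite-index subgroup, and \<open>\<tau>\<close> maps it
  into \<open>U\<^sub>n\<close>.\<close>

lemma carrier_Aut_stabilized:
  "carrier Aut_inf =
    {F \<in> Bij (odometer G \<Gamma>). homeomorphic_map T T F \<and> (\<exists>n. commutes_at n F)}"
proof (intro equalityI subsetI)
  fix F assume "F \<in> carrier Aut_inf"
  then obtain K where K: "finite_index_subgroup K G" "F \<in> Bij (odometer G \<Gamma>)" "homeomorphic_map T T F"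
    "\<And>g x. \<lbrakk>g \<in> K; x \<in> odometer G \<Gamma>\<rbrakk> \<Longrightarrow>
      F (odometer_action G \<Gamma> g x) = odometer_action G \<Gamma> g (F x)"
    by (auto simp: Aut_stabilized_def Aut_system_def homeo_centralizer_def)
  have F: "continuous_map T T F" using K(3) by (rule homeomorphic_imp_continuous_map)
  then have "F x \<in> odometer G \<Gamma>" if "x \<in> odometer G \<Gamma>" for x
    using that by (auto simp: self.continuous_map_iff)
  then have "\<exists>n. commutes_at n F"
    using K(4) by (intro commutes_at_if_commutes[OF F K(1)]) (simp add: action_eq)
  then show "F \<in> {F \<in> Bij (odometer G \<Gamma>). homeomorphic_map T T F \<and> (\<exists>n. commutes_at n F)}"
    using K by blast
next
  fix F assume "F \<in> {F \<in> Bij (odometer G \<Gamma>). homeomorphic_map T T F \<and> (\<exists>n. commutes_at n F)}"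
  then obtain n where F: "F \<in> Bij (odometer G \<Gamma>)" "homeomorphic_map T T F" "commutes_at n F"
    by blast
  have FX: "F x \<in> odometer G \<Gamma>" if "x \<in> odometer G \<Gamma>" for x
    using that F(1) by (auto simp: Bij_def bij_betw_def)
  have fi: "finite_index_subgroup (\<Gamma> n) G" using scale by (simp add: group_scale_def)
  have "F (odometer_action G \<Gamma> g x) = odometer_action G \<Gamma> g (F x)"
    if "g \<in> \<Gamma> n" "x \<in> odometer G \<Gamma>" for g x
  proof -
    have "g \<in> carrier G"
      using that(1) subgroup.subset[OF normal_imp_subgroup[OF normal_scale]] by blast
    then show ?thesis
      using that F(3) FX embedding_one_at_iff by (simp add: action_eq commutes_at_def)
  qed
  then have "F \<in> homeo_centralizer T (odometer_action G \<Gamma>) (G\<lparr>carrier := \<Gamma> n\<rparr>)"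
    using F by (simp add: homeo_centralizer_def)
  then show "F \<in> carrier Aut_inf"
    using fi by (auto simp: Aut_stabilized_def Aut_system_def)
qed

end

section \<open>Conjugation by homeomorphisms that are multiplicative on a level subgroup\<close>

context odometer_pair begin

text \<open>Only the left factor is confined to \<open>U\<^sub>n\<close>. Thus \<open>\<psi>\<close>
  need not be a homomorphism, but it turns left multiplication by \<open>u\<close> into left
  multiplication by \<open>\<psi> u\<close>.\<close>

definition level_hom :: "nat \<Rightarrow> ((nat \<Rightarrow> 'a set) \<Rightarrow> nat \<Rightarrow> 'b set) \<Rightarrow> bool"
  where "level_hom n \<psi> \<longleftrightarrow>
    (\<forall>u\<in>odometer G \<Gamma>. u n = \<Gamma> n \<longrightarrow>
      (\<forall>x\<in>odometer G \<Gamma>. \<psi> (u \<otimes>\<^bsub>A.odo_grp\<^esub> x) = \<psi> u \<otimes>\<^bsub>B.odo_grp\<^esub> \<psi> x))"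

text \<open>The restriction makes the conjugate extensional, as membership in \<open>Bij\<close>
  demands.\<close>

definition conj :: "((nat \<Rightarrow> 'a set) \<Rightarrow> nat \<Rightarrow> 'b set) \<Rightarrow> ((nat \<Rightarrow> 'b set) \<Rightarrow> nat \<Rightarrow> 'a set)
    \<Rightarrow> ((nat \<Rightarrow> 'a set) \<Rightarrow> nat \<Rightarrow> 'a set) \<Rightarrow> (nat \<Rightarrow> 'b set) \<Rightarrow> nat \<Rightarrow> 'b set"
  where "conj \<psi> \<theta> F = (\<lambda>y\<in>odometer H \<Delta>. \<psi> (F (\<theta> y)))"

sublocale converse: odometer_pair H \<Delta> G \<Gamma> ..

text \<open>Taking both factors trivial shows that the value of \<open>\<psi>\<close> at the
  identity is idempotent, hence trivial. So \<open>\<theta>\<close> fixes the identity, and its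
  continuity there gives a level \<open>k\<close> with \<open>\<theta>\<close> mapping
  \<open>U\<^sub>k\<close> into \<open>U\<^sub>n\<close>, where multiplicativity of
  \<open>\<psi>\<close> can be inverted.\<close>

lemma level_hom_inverse:
  assumes hm: "homeomorphic_maps A.T B.T \<psi> \<theta>" and lh: "level_hom n \<psi>"
  shows "\<exists>k. converse.level_hom k \<theta> \<and> (\<forall>v\<in>odometer H \<Delta>. v k = \<Delta> k \<longrightarrow> \<theta> v n = \<Gamma> n)"
proof -
  have \<psi>X: "\<psi> x \<in> odometer H \<Delta>" if "x \<in> odometer G \<Gamma>" for x
    using that hm by (auto simp: homeomorphic_maps_def continuous_map_iff)
  have \<theta>: "continuous_map B.T A.T \<theta>" using hm by (simp add: homeomorphic_maps_def)
  then have \<theta>Y: "\<theta> y \<in> odometer G \<Gamma>" if "y \<in> odometer H \<Delta>" for y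
    using that by (auto simp: converse.continuous_map_iff)
  have inv: "\<And>x. x \<in> odometer G \<Gamma> \<Longrightarrow> \<theta> (\<psi> x) = x" "\<And>y. y \<in> odometer H \<Delta> \<Longrightarrow> \<psi> (\<theta> y) = y"
    using hm by (auto simp: homeomorphic_maps_def)
  have "\<psi> \<one>\<^bsub>A.odo_grp\<^esub> = \<psi> \<one>\<^bsub>A.odo_grp\<^esub> \<otimes>\<^bsub>B.odo_grp\<^esub> \<psi> \<one>\<^bsub>A.odo_grp\<^esub>"
    using lh A.X_closed(3) A.X.r_one[of "\<one>\<^bsub>A.odo_grp\<^esub>"] unfolding level_hom_def
    by (metis A.one_at A.carrier_X)
  then have "\<psi> \<one>\<^bsub>A.odo_grp\<^esub> = \<one>\<^bsub>B.odo_grp\<^esub>"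
    using B.X.r_cancel_one'[of "\<psi> \<one>\<^bsub>A.odo_grp\<^esub>" "\<psi> \<one>\<^bsub>A.odo_grp\<^esub>"] \<psi>X by simp
  then have \<theta>1: "\<theta> \<one>\<^bsub>B.odo_grp\<^esub> = \<one>\<^bsub>A.odo_grp\<^esub>" using inv(1) by (metis A.X_closed(3))
  obtain k where k: "\<And>v. \<lbrakk>v \<in> odometer H \<Delta>; v k = \<one>\<^bsub>B.odo_grp\<^esub> k\<rbrakk> \<Longrightarrow> \<theta> v n = \<theta> \<one>\<^bsub>B.odo_grp\<^esub> n"
    using converse.continuous_atE[OF \<theta>, of "\<one>\<^bsub>B.odo_grp\<^esub>"] by auto
  have "\<theta> (v \<otimes>\<^bsub>B.odo_grp\<^esub> y) = \<theta> v \<otimes>\<^bsub>A.odo_grp\<^esub> \<theta> y"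
    if "v \<in> odometer H \<Delta>" "v k = \<Delta> k" "y \<in> odometer H \<Delta>" for v y
  proof -
    have "\<psi> (\<theta> v \<otimes>\<^bsub>A.odo_grp\<^esub> \<theta> y) = v \<otimes>\<^bsub>B.odo_grp\<^esub> y"
      using lh k[of v] that \<theta>Y inv \<theta>1 by (simp add: level_hom_def)
    then show ?thesis using inv(1) \<theta>Y that by (metis A.X_closed(1))
  qed
  then show ?thesis
    using k \<theta>1 by (intro exI[of _ k]) (simp add: converse.level_hom_def)
qed

text \<open>For \<open>v\<close> in a small enough level subgroup, left multiplication by
  \<open>v\<close> passes through \<open>\<theta>\<close>, then \<open>F\<close>, then
  \<open>\<psi>\<close>, becoming multiplication by \<open>\<theta> v\<close> in between and by
  \<open>v\<close> again at the end.\<close>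

lemma conj_in_Aut:
  assumes hm: "homeomorphic_maps A.T B.T \<psi> \<theta>" and lh: "level_hom n \<psi>"
    and F: "F \<in> carrier A.Aut_inf"
  shows "conj \<psi> \<theta> F \<in> carrier B.Aut_inf"
proof -
  obtain m where Fh: "homeomorphic_map A.T A.T F" and m: "A.commutes_at m F"
    using F by (auto simp: A.carrier_Aut_stabilized)
  have \<theta>Y: "\<theta> y \<in> odometer G \<Gamma>" if "y \<in> odometer H \<Delta>" for y
    using that hm by (auto simp: homeomorphic_maps_def converse.continuous_map_iff)
  have FX: "F x \<in> odometer G \<Gamma>" if "x \<in> odometer G \<Gamma>" for x
    using that homeomorphic_imp_continuous_map[OF Fh] by (auto simp: A.self.continuous_map_iff)
  have "homeomorphic_map B.T B.T (\<psi> \<circ> (F \<circ> \<theta>))"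
    using homeomorphic_maps_map[of A.T B.T \<psi> \<theta>] hm Fh
    by (intro homeomorphic_map_compose[of B.T A.T]) simp_all
  then have h: "homeomorphic_map B.T B.T (conj \<psi> \<theta> F)"
    by (rule homeomorphic_map_eq) (simp add: conj_def)
  have "bij_betw (conj \<psi> \<theta> F) (odometer H \<Delta>) (odometer H \<Delta>)"
    using h by (simp add: homeomorphic_eq_everything_map bij_betw_def)
  then have b: "conj \<psi> \<theta> F \<in> Bij (odometer H \<Delta>)"
    by (simp add: Bij_def conj_def)
  \<comment> \<open>Below \<open>max m n\<close>, both \<open>F\<close> commutes with the level
    subgroup and \<open>\<psi>\<close> is multiplicative; \<open>\<theta>\<close> has to land
    there.\<close>
  have "level_hom (max m n) \<psi>"
    unfolding level_hom_def
  proof (intro ballI impI)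
    fix u x assume u: "u \<in> odometer G \<Gamma>" "u (max m n) = \<Gamma> (max m n)" and x: "x \<in> odometer G \<Gamma>"
    have "u n = \<one>\<^bsub>A.odo_grp\<^esub> n"
      using u A.eq_at_le[of u "\<one>\<^bsub>A.odo_grp\<^esub>" "max m n" n] by auto
    then show "\<psi> (u \<otimes>\<^bsub>A.odo_grp\<^esub> x) = \<psi> u \<otimes>\<^bsub>B.odo_grp\<^esub> \<psi> x"
      using lh u x by (simp add: level_hom_def)
  qed
  from level_hom_inverse[OF hm this] obtain k where k: "converse.level_hom k \<theta>"
    "\<And>v. \<lbrakk>v \<in> odometer H \<Delta>; v k = \<Delta> k\<rbrakk> \<Longrightarrow> \<theta> v (max m n) = \<Gamma> (max m n)"
    by blast
  have "B.commutes_at k (conj \<psi> \<theta> F)"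
    unfolding B.commutes_at_def
  proof (intro ballI impI)
    fix v y assume v: "v \<in> odometer H \<Delta>" "v k = \<Delta> k" and y: "y \<in> odometer H \<Delta>"
    have u: "\<theta> v (max m n) = \<one>\<^bsub>A.odo_grp\<^esub> (max m n)" using k v by simp
    have um: "\<theta> v m = \<Gamma> m" "\<theta> v n = \<Gamma> n"
      using A.eq_at_le[of "\<theta> v" "\<one>\<^bsub>A.odo_grp\<^esub>" "max m n" m] A.eq_at_le[of "\<theta> v" "\<one>\<^bsub>A.odo_grp\<^esub>" "max m n" n]
        u \<theta>Y v by auto
    have "\<psi> (F (\<theta> (v \<otimes>\<^bsub>B.odo_grp\<^esub> y))) = \<psi> (\<theta> v \<otimes>\<^bsub>A.odo_grp\<^esub> F (\<theta> y))"
      using k(1) v y m um(1) \<theta>Y by (simp add: converse.level_hom_def A.commutes_at_def)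
    also have "\<dots> = \<psi> (\<theta> v) \<otimes>\<^bsub>B.odo_grp\<^esub> \<psi> (F (\<theta> y))"
      using lh um(2) \<theta>Y FX v y by (simp add: level_hom_def)
    also have "\<psi> (\<theta> v) = v" using hm v by (simp add: homeomorphic_maps_def)
    finally show "conj \<psi> \<theta> F (v \<otimes>\<^bsub>B.odo_grp\<^esub> y) = v \<otimes>\<^bsub>B.odo_grp\<^esub> conj \<psi> \<theta> F y"
      using v y by (simp add: conj_def)
  qed
  then show ?thesis using h b by (auto simp: B.carrier_Aut_stabilized)
qed

lemma conj_conj:
  assumes hm: "homeomorphic_maps A.T B.T \<psi> \<theta>" and F: "F \<in> Bij (odometer G \<Gamma>)"
  shows "converse.conj \<theta> \<psi> (conj \<psi> \<theta> F) = F"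
proof
  fix x
  show "converse.conj \<theta> \<psi> (conj \<psi> \<theta> F) x = F x"
  proof (cases "x \<in> odometer G \<Gamma>")
    case True
    then have "F x \<in> odometer G \<Gamma>" "\<psi> x \<in> odometer H \<Delta>"
      using F hm by (auto simp: Bij_def bij_betw_def homeomorphic_maps_def continuous_map_iff)
    then show ?thesis
      using True hm by (simp add: conj_def converse.conj_def homeomorphic_maps_def)
  next
    case False
    then show ?thesis using F by (simp add: converse.conj_def Bij_def extensional_def)
  qed
qed

end

context odometer_pair begin

text \<open>By \<open>level_hom_inverse\<close> the situation is symmetric in \<open>\<psi>\<close>
  and \<open>\<theta>\<close>, so conjugation the other way also preserves the stabilized groups and
  is the inverse.\<close>

theorem Aut_stabilized_iso:
  assumes hm: "homeomorphic_maps A.T B.T \<psi> \<theta>" and lh: "level_hom n \<psi>"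
  shows "A.Aut_inf \<cong> B.Aut_inf"
proof -
  have hm': "homeomorphic_maps B.T A.T \<theta> \<psi>" using hm homeomorphic_maps_sym by blast
  obtain k where k: "converse.level_hom k \<theta>" using level_hom_inverse[OF hm lh] by blast
  have A: "carrier A.Aut_inf \<subseteq> Bij (odometer G \<Gamma>)" and B: "carrier B.Aut_inf \<subseteq> Bij (odometer H \<Delta>)"
    by (auto simp: A.carrier_Aut_stabilized B.carrier_Aut_stabilized)
  \<comment> \<open>The operation of \<open>BijGroup\<close> is restricted to \<open>Bij\<close>, so
    it unfolds to composition only for members.\<close>
  have mA: "F \<otimes>\<^bsub>A.Aut_inf\<^esub> F' = compose (odometer G \<Gamma>) F F'"
    if "F \<in> carrier A.Aut_inf" "F' \<in> carrier A.Aut_inf" for F F'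
  proof -
    have "F \<otimes>\<^bsub>A.Aut_inf\<^esub> F' = F \<otimes>\<^bsub>BijGroup (odometer G \<Gamma>)\<^esub> F'" by (simp add: Aut_stabilized_def)
    moreover have "F \<in> Bij (odometer G \<Gamma>)" "F' \<in> Bij (odometer G \<Gamma>)" using that A by blast+
    ultimately show ?thesis by (simp add: BijGroup_def)
  qed
  have mB: "F \<otimes>\<^bsub>B.Aut_inf\<^esub> F' = compose (odometer H \<Delta>) F F'"
    if "F \<in> carrier B.Aut_inf" "F' \<in> carrier B.Aut_inf" for F F'
  proof -
    have "F \<otimes>\<^bsub>B.Aut_inf\<^esub> F' = F \<otimes>\<^bsub>BijGroup (odometer H \<Delta>)\<^esub> F'" by (simp add: Aut_stabilized_def)
    moreover have "F \<in> Bij (odometer H \<Delta>)" "F' \<in> Bij (odometer H \<Delta>)" using that B by blast+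
    ultimately show ?thesis by (simp add: BijGroup_def)
  qed
  have "conj \<psi> \<theta> \<in> hom A.Aut_inf B.Aut_inf"
  proof (rule homI)
    fix F F' assume F: "F \<in> carrier A.Aut_inf" and F': "F' \<in> carrier A.Aut_inf"
    have \<theta>Y: "\<theta> y \<in> odometer G \<Gamma>" if "y \<in> odometer H \<Delta>" for y
      using that hm by (auto simp: homeomorphic_maps_def converse.continuous_map_iff)
    have F'X: "F' x \<in> odometer G \<Gamma>" if "x \<in> odometer G \<Gamma>" for x
      using that A F' by (auto simp: Bij_def bij_betw_def)
    have \<psi>X: "\<psi> x \<in> odometer H \<Delta>" if "x \<in> odometer G \<Gamma>" for x
      using that hm by (auto simp: homeomorphic_maps_def continuous_map_iff)
    have "conj \<psi> \<theta> (compose (odometer G \<Gamma>) F F') =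
        compose (odometer H \<Delta>) (conj \<psi> \<theta> F) (conj \<psi> \<theta> F')"
    proof
      fix y
      show "conj \<psi> \<theta> (compose (odometer G \<Gamma>) F F') y =
          compose (odometer H \<Delta>) (conj \<psi> \<theta> F) (conj \<psi> \<theta> F') y"
      proof (cases "y \<in> odometer H \<Delta>")
        case True
        then show ?thesis using \<theta>Y[of y] F'X[of "\<theta> y"] \<psi>X[of "F' (\<theta> y)"] hm
          by (simp add: conj_def compose_def homeomorphic_maps_def)
      next
        case False
        then show ?thesis by (simp add: conj_def compose_def)
      qed
    qed
    then show "conj \<psi> \<theta> (F \<otimes>\<^bsub>A.Aut_inf\<^esub> F') = conj \<psi> \<theta> F \<otimes>\<^bsub>B.Aut_inf\<^esub> conj \<psi> \<theta> F'"
      by (simp only: mA[OF F F'] mB conj_in_Aut[OF hm lh] F F')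
  qed (rule conj_in_Aut[OF hm lh])
  moreover have "bij_betw (conj \<psi> \<theta>) (carrier A.Aut_inf) (carrier B.Aut_inf)"
  proof (rule bij_betw_byWitness[where f' = "converse.conj \<theta> \<psi>"])
    show "\<forall>F\<in>carrier A.Aut_inf. converse.conj \<theta> \<psi> (conj \<psi> \<theta> F) = F"
      using A conj_conj[OF hm] by blast
    show "\<forall>F\<in>carrier B.Aut_inf. conj \<psi> \<theta> (converse.conj \<theta> \<psi> F) = F"
      using B converse.conj_conj[OF hm'] by blast
    show "conj \<psi> \<theta> ` carrier A.Aut_inf \<subseteq> carrier B.Aut_inf"
      using conj_in_Aut[OF hm lh] by blast
    show "converse.conj \<theta> \<psi> ` carrier B.Aut_inf \<subseteq> carrier A.Aut_inf"
      using converse.conj_in_Aut[OF hm' k] by blast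
  qed
  ultimately show ?thesis by (auto simp: is_iso_def iso_def)
qed

end

section \<open>Continuous orbit equivalences\<close>

context odometer_space begin

text \<open>The sets where \<open>P n\<close> holds are open by \<open>mono\<close> and cover the
  compact odometer; the largest index in a finite subcover works everywhere, again by
  \<open>mono\<close>.\<close>

lemma uniform_level:
  assumes ex: "\<And>x. x \<in> odometer G \<Gamma> \<Longrightarrow> \<exists>n. P n x"
    and mono: "\<And>m n x y. \<lbrakk>P n x; x \<in> odometer G \<Gamma>; y \<in> odometer G \<Gamma>; y n = x n; n \<le> m\<rbrakk> \<Longrightarrow> P m y"
  shows "\<exists>N. \<forall>x\<in>odometer G \<Gamma>. P N x"
proof -
  let ?U = "\<lambda>n. {x \<in> odometer G \<Gamma>. P n x}"
  have "openin T (?U n)" for n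
    using mono[of n _ _ n] by (auto simp: openin_odometer_iff)
  moreover have "topspace T \<subseteq> \<Union>(range ?U)" using ex by auto
  ultimately obtain \<F> where \<F>: "finite \<F>" "\<F> \<subseteq> range ?U" "topspace T \<subseteq> \<Union>\<F>"
    using compact_odometer unfolding compact_space_alt by (metis (no_types, lifting) imageE)
  then obtain I where I: "finite I" "\<F> = ?U ` I" by (meson finite_subset_image)
  then obtain N where "\<And>n. n \<in> I \<Longrightarrow> n \<le> N" by (auto simp: finite_nat_set_iff_bounded_le)
  then have "P N x" if "x \<in> odometer G \<Gamma>" for x
    using mono[of _ x x N] I \<F>(3) that by auto
  then show ?thesis by blast
qed

end

section \<open>A level at which the orbit cocycle is locally constant\<close>

context odometer_pair begin

text \<open>Compactness yields a level for each group element, and \<open>N\<close> bounds those of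
  the finitely many generators and their inverses. Along a word the level does not grow, because
  left multiplication preserves agreement at coordinate \<open>N\<close>.\<close>

lemma cocycle_uniform:
  assumes fg: "finitely_generated_group G" and \<phi>X: "\<phi> \<in> odometer G \<Gamma> \<rightarrow> odometer H \<Delta>"
    and loc: "\<And>g x. \<lbrakk>g \<in> carrier G; x \<in> odometer G \<Gamma>\<rbrakk> \<Longrightarrow> \<exists>n. \<exists>h\<in>carrier H.
      \<forall>y\<in>odometer G \<Gamma>. y n = x n \<longrightarrow> \<phi> (A.\<tau> g \<otimes>\<^bsub>A.odo_grp\<^esub> y) = B.\<tau> h \<otimes>\<^bsub>B.odo_grp\<^esub> \<phi> y"
  shows "\<exists>N. \<forall>g\<in>carrier G. \<forall>x\<in>odometer G \<Gamma>. \<exists>h\<in>carrier H.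
    \<forall>y\<in>odometer G \<Gamma>. y N = x N \<longrightarrow> \<phi> (A.\<tau> g \<otimes>\<^bsub>A.odo_grp\<^esub> y) = B.\<tau> h \<otimes>\<^bsub>B.odo_grp\<^esub> \<phi> y"
proof -
  define Q where "Q g n x \<longleftrightarrow> (\<exists>h\<in>carrier H. \<forall>y\<in>odometer G \<Gamma>. y n = x n \<longrightarrow>
    \<phi> (A.\<tau> g \<otimes>\<^bsub>A.odo_grp\<^esub> y) = B.\<tau> h \<otimes>\<^bsub>B.odo_grp\<^esub> \<phi> y)" for g n x
  have mono: "Q g m y"
    if "Q g n x" "x \<in> odometer G \<Gamma>" "y \<in> odometer G \<Gamma>" "y n = x n" "n \<le> m" for g m n x y
    using that A.eq_at_le[of _ y m n] unfolding Q_def by (metis (no_types))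
  obtain S where S: "finite S" "S \<subseteq> carrier G" "generate G S = carrier G"
    using fg by (auto simp: finitely_generated_group_def)
  \<comment> \<open>\<open>generate\<close> has separate base cases for a generator and for its
    inverse; \<open>N\<close> must cover both.\<close>
  define S' where "S' = S \<union> m_inv G ` S"
  have S': "finite S'" "S' \<subseteq> carrier G" using S by (auto simp: S'_def)
  have "\<exists>N. \<forall>x\<in>odometer G \<Gamma>. Q g N x" if "g \<in> carrier G" for g
  proof (rule A.uniform_level)
    show "\<exists>n. Q g n x" if "x \<in> odometer G \<Gamma>" for x
      unfolding Q_def using loc \<open>g \<in> carrier G\<close> that by blast
  qed (rule mono)
  then obtain n where n: "\<And>g x. \<lbrakk>g \<in> carrier G; x \<in> odometer G \<Gamma>\<rbrakk> \<Longrightarrow> Q g (n g) x"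
    by metis
  obtain N where N: "\<And>g. g \<in> S' \<Longrightarrow> n g \<le> N"
    using finite_imageI[OF S'(1), of n] by (auto simp: finite_nat_set_iff_bounded_le)
  have base: "Q g N x" if "g \<in> S'" "x \<in> odometer G \<Gamma>" for g x
    using mono[OF n[of g x], of x N] N[of g] that S' by auto
  have "\<forall>x\<in>odometer G \<Gamma>. Q g N x" if "g \<in> generate G S" for g
    using that
  proof induction
    case one
    show ?case
      using \<phi>X by (auto simp: Q_def Pi_iff intro!: bexI[of _ "\<one>\<^bsub>H\<^esub>"])
  next
    case (incl g) then show ?case using base by (simp add: S'_def)
  next
    case (inv g) then show ?case using base by (simp add: S'_def)
  next
    case (eng g1 g2)
    then have g: "g1 \<in> carrier G" "g2 \<in> carrier G" using S(3) by auto
    show ?case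
    proof
      fix x assume x: "x \<in> odometer G \<Gamma>"
      \<comment> \<open>Points agreeing with \<open>x\<close> at \<open>N\<close> still agree at
        \<open>N\<close> after multiplication by the image of \<open>g2\<close>. So the value for
        \<open>g1\<close>, taken at the translated point, serves all of them.\<close>
      obtain h2 where h2: "h2 \<in> carrier H" "\<And>y. \<lbrakk>y \<in> odometer G \<Gamma>; y N = x N\<rbrakk> \<Longrightarrow>
          \<phi> (A.\<tau> g2 \<otimes>\<^bsub>A.odo_grp\<^esub> y) = B.\<tau> h2 \<otimes>\<^bsub>B.odo_grp\<^esub> \<phi> y"
        using eng.IH(2) x by (auto simp: Q_def)
      have "A.\<tau> g2 \<otimes>\<^bsub>A.odo_grp\<^esub> x \<in> odometer G \<Gamma>" using g x by simp
      then obtain h1 where h1: "h1 \<in> carrier H"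
        "\<And>y. \<lbrakk>y \<in> odometer G \<Gamma>; y N = (A.\<tau> g2 \<otimes>\<^bsub>A.odo_grp\<^esub> x) N\<rbrakk> \<Longrightarrow>
          \<phi> (A.\<tau> g1 \<otimes>\<^bsub>A.odo_grp\<^esub> y) = B.\<tau> h1 \<otimes>\<^bsub>B.odo_grp\<^esub> \<phi> y"
        using eng.IH(1) by (auto simp: Q_def)
      have "\<phi> (A.\<tau> (g1 \<otimes>\<^bsub>G\<^esub> g2) \<otimes>\<^bsub>A.odo_grp\<^esub> y) = B.\<tau> (h1 \<otimes>\<^bsub>H\<^esub> h2) \<otimes>\<^bsub>B.odo_grp\<^esub> \<phi> y"
        if y: "y \<in> odometer G \<Gamma>" "y N = x N" for y
      proof -
        have "\<phi> y \<in> odometer H \<Delta>" using y \<phi>X by auto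
        then show ?thesis
          using y g h1(1) h2 h1(2)[of "A.\<tau> g2 \<otimes>\<^bsub>A.odo_grp\<^esub> y"]
          by (simp add: A.X.m_assoc B.X.m_assoc A.mult_at)
      qed
      then show "Q (g1 \<otimes>\<^bsub>G\<^esub> g2) N x" using h1(1) h2(1) unfolding Q_def by blast
    qed
  qed
  then show ?thesis using S(3) unfolding Q_def by blast
qed

end

context odometer_space begin

lemma homeomorphic_map_inv: "homeomorphic_map T T (m_inv odo_grp)"
proof -
  have c: "continuous_map T T (m_inv odo_grp)"
    unfolding self.continuous_map_iff
  proof (intro conjI ballI allI)
    show "\<exists>k. \<forall>y\<in>odometer G \<Gamma>. y k = x k \<longrightarrow> (inv\<^bsub>odo_grp\<^esub> y) n = (inv\<^bsub>odo_grp\<^esub> x) n"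
      if "x \<in> odometer G \<Gamma>" for x n
      by (intro exI[of _ n] ballI impI inv_cong_at that)
  qed simp
  have "homeomorphic_maps T T (m_inv odo_grp) (m_inv odo_grp)"
    using c by (simp add: homeomorphic_maps_def)
  then show ?thesis unfolding homeomorphic_map_maps by blast
qed

lemma homeomorphic_map_right_mult:
  assumes c: "c \<in> odometer G \<Gamma>"
  shows "homeomorphic_map T T (\<lambda>x. x \<otimes>\<^bsub>odo_grp\<^esub> c)"
proof -
  have *: "continuous_map T T (\<lambda>x. x \<otimes>\<^bsub>odo_grp\<^esub> d)" if "d \<in> odometer G \<Gamma>" for d
    unfolding self.continuous_map_iff
  proof (intro conjI ballI allI)
    show "\<exists>k. \<forall>y\<in>odometer G \<Gamma>. y k = x k \<longrightarrow> (y \<otimes>\<^bsub>odo_grp\<^esub> d) n = (x \<otimes>\<^bsub>odo_grp\<^esub> d) n" for x n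
      by (intro exI[of _ n]) (simp add: mult_at)
  qed (use that in simp)
  have "homeomorphic_maps T T (\<lambda>x. x \<otimes>\<^bsub>odo_grp\<^esub> c) (\<lambda>x. x \<otimes>\<^bsub>odo_grp\<^esub> inv\<^bsub>odo_grp\<^esub> c)"
    using *[OF c] *[of "inv\<^bsub>odo_grp\<^esub> c"] c by (simp add: homeomorphic_maps_def X.m_assoc)
  then show ?thesis unfolding homeomorphic_map_maps by blast
qed

text \<open>The subgroups of the scale separate elements from the identity. This supplies residual
  finiteness of the two groups in the counterexample.\<close>

lemma residually_finite: "residually_finite_group G"
  unfolding residually_finite_group_def
proof (intro conjI ballI impI)
  fix g assume "g \<noteq> \<one>\<^bsub>G\<^esub>"
  then obtain n where "g \<notin> \<Gamma> n" using scale by (auto simp: group_scale_def)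
  then show "\<exists>N. N \<lhd> G \<and> finite_index_subgroup N G \<and> g \<notin> N"
    using scale by (auto simp: group_scale_def)
qed (rule G.group_axioms)

end

section \<open>From orbit equivalences to maps multiplicative on a level subgroup\<close>

context odometer_pair begin

text \<open>Near \<open>x\<close> both maps have constant coordinate \<open>n\<close>, and by
  density some \<open>A.\<tau> g\<close> lies that near.\<close>

lemma eq_if_eq_on_embedding:
  assumes f: "continuous_map A.T B.T f" and f': "continuous_map A.T B.T f'"
    and eq: "\<And>g. g \<in> carrier G \<Longrightarrow> f (A.\<tau> g) = f' (A.\<tau> g)"
    and x: "x \<in> odometer G \<Gamma>"
  shows "f x = f' x"
proof
  fix n
  obtain k where k: "\<And>y. \<lbrakk>y \<in> odometer G \<Gamma>; y k = x k\<rbrakk> \<Longrightarrow> f y n = f x n"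
    using continuous_atE[OF f x, where n = n] by metis
  obtain k' where k': "\<And>y. \<lbrakk>y \<in> odometer G \<Gamma>; y k' = x k'\<rbrakk> \<Longrightarrow> f' y n = f' x n"
    using continuous_atE[OF f' x, where n = n] by metis
  obtain g where g: "g \<in> carrier G" "A.\<tau> g (max k k') = x (max k k')"
    using A.embedding_dense[OF x] by metis
  then have "A.\<tau> g k = x k" "A.\<tau> g k' = x k'"
    using A.eq_at_le[of "A.\<tau> g" x "max k k'"] x by auto
  then show "f x n = f' x n" using k[of "A.\<tau> g"] k'[of "A.\<tau> g"] g(1) eq by simp
qed

text \<open>Mirror image of \<open>level_hom\<close>, with the element of \<open>U\<^sub>n\<close>
  on the right. The cocycle yields this side because the groups act by left multiplication.\<close>

definition level_right_hom :: "nat \<Rightarrow> ((nat \<Rightarrow> 'a set) \<Rightarrow> nat \<Rightarrow> 'b set) \<Rightarrow> bool"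
  where "level_right_hom n \<phi> \<longleftrightarrow>
    (\<forall>x\<in>odometer G \<Gamma>. \<forall>u\<in>odometer G \<Gamma>. u n = \<Gamma> n \<longrightarrow>
      \<phi> (x \<otimes>\<^bsub>A.odo_grp\<^esub> u) = \<phi> x \<otimes>\<^bsub>B.odo_grp\<^esub> \<phi> u)"

text \<open>The cocycle value of \<open>g\<close> is the same at all points of
  \<open>U\<^sub>N\<close>. At the identity it is read off from \<open>\<phi> (A.\<tau> g)\<close>,
  which gives multiplicativity for \<open>x\<close> in the image of \<open>G\<close>; density gives
  the rest. The last conclusion, on the orbit of the identity, is what the counterexample
  needs.\<close>

lemma orbit_equivalence_right_hom:
  assumes fg: "finitely_generated_group G"
    and coe: "continuously_orbit_equivalent A.T (odometer_action G \<Gamma>) G B.T (odometer_action H \<Delta>) H"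
  shows "\<exists>\<phi> N. homeomorphic_map A.T B.T \<phi> \<and> level_right_hom N \<phi> \<and>
    \<phi> ` A.\<tau> ` carrier G \<subseteq> B.\<tau> ` carrier H"
proof -
  obtain f where "homeomorphic_map A.T B.T f \<and>
      bij_betw (\<lambda>C. f ` C) (orbits G (topspace A.T) (odometer_action G \<Gamma>))
        (orbits H (topspace B.T) (odometer_action H \<Delta>)) \<and>
      (\<forall>g\<in>carrier G. \<forall>x\<in>topspace A.T. \<exists>U h. openin A.T U \<and> closedin A.T U \<and> x \<in> U \<and>
        h \<in> carrier H \<and> (\<forall>y\<in>U. f (odometer_action G \<Gamma> g y) = odometer_action H \<Delta> h (f y)))"
    using coe unfolding continuously_orbit_equivalent_def by (rule exE)
  then have fh: "homeomorphic_map A.T B.T f" and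
    f: "\<And>g x. \<lbrakk>g \<in> carrier G; x \<in> topspace A.T\<rbrakk> \<Longrightarrow> \<exists>U h. openin A.T U \<and> closedin A.T U \<and> x \<in> U \<and>
      h \<in> carrier H \<and> (\<forall>y\<in>U. f (odometer_action G \<Gamma> g y) = odometer_action H \<Delta> h (f y))"
    by simp_all
  have "continuous_map A.T B.T f" using fh by (rule homeomorphic_imp_continuous_map)
  then have fX: "f x \<in> odometer H \<Delta>" if "x \<in> odometer G \<Gamma>" for x
    using that by (auto simp: continuous_map_iff)
  \<comment> \<open>Right multiplication commutes with the action, so normalizing \<open>f\<close>
    to fix the identity leaves its cocycle unchanged.\<close>
  define c where "c = inv\<^bsub>B.odo_grp\<^esub> f \<one>\<^bsub>A.odo_grp\<^esub>"
  have c: "c \<in> odometer H \<Delta>" using fX by (simp add: c_def)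
  define \<phi> where "\<phi> x = f x \<otimes>\<^bsub>B.odo_grp\<^esub> c" for x
  have "homeomorphic_map A.T B.T ((\<lambda>y. y \<otimes>\<^bsub>B.odo_grp\<^esub> c) \<circ> f)"
    by (rule homeomorphic_map_compose[OF fh B.homeomorphic_map_right_mult[OF c]])
  moreover have "(\<lambda>y. y \<otimes>\<^bsub>B.odo_grp\<^esub> c) \<circ> f = \<phi>" by (simp add: \<phi>_def fun_eq_iff)
  ultimately have \<phi>h: "homeomorphic_map A.T B.T \<phi>" by simp
  then have \<phi>c: "continuous_map A.T B.T \<phi>" by (rule homeomorphic_imp_continuous_map)
  have \<phi>X: "\<phi> x \<in> odometer H \<Delta>" if "x \<in> odometer G \<Gamma>" for x
    using that fX c by (simp add: \<phi>_def)
  have \<phi>1: "\<phi> \<one>\<^bsub>A.odo_grp\<^esub> = \<one>\<^bsub>B.odo_grp\<^esub>" using fX by (simp add: \<phi>_def c_def)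
  have loc: "\<exists>n. \<exists>h\<in>carrier H. \<forall>y\<in>odometer G \<Gamma>. y n = x n \<longrightarrow>
      \<phi> (A.\<tau> g \<otimes>\<^bsub>A.odo_grp\<^esub> y) = B.\<tau> h \<otimes>\<^bsub>B.odo_grp\<^esub> \<phi> y"
    if g: "g \<in> carrier G" and x: "x \<in> odometer G \<Gamma>" for g x
  proof -
    obtain U h where U: "openin A.T U" "x \<in> U" and h: "h \<in> carrier H"
      and Uh: "\<And>y. y \<in> U \<Longrightarrow> f (odometer_action G \<Gamma> g y) = odometer_action H \<Delta> h (f y)"
      using f[OF g x[folded topspace_odometer_topology]] by blast
    obtain n where n: "\<And>y. \<lbrakk>y \<in> odometer G \<Gamma>; y n = x n\<rbrakk> \<Longrightarrow> y \<in> U"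
      using U unfolding A.openin_odometer_iff by blast
    have "\<phi> (A.\<tau> g \<otimes>\<^bsub>A.odo_grp\<^esub> y) = B.\<tau> h \<otimes>\<^bsub>B.odo_grp\<^esub> \<phi> y"
      if "y \<in> odometer G \<Gamma>" "y n = x n" for y
      using Uh[OF n[OF that]] that(1) fX[OF that(1)] h c
      by (simp add: \<phi>_def A.action_eq B.action_eq B.X.m_assoc)
    then show ?thesis using h by blast
  qed
  have "\<phi> \<in> odometer G \<Gamma> \<rightarrow> odometer H \<Delta>" using \<phi>X by blast
  from cocycle_uniform[OF fg this loc] obtain N where N:
    "\<And>g x. \<lbrakk>g \<in> carrier G; x \<in> odometer G \<Gamma>\<rbrakk> \<Longrightarrow> \<exists>h\<in>carrier H.
      \<forall>y\<in>odometer G \<Gamma>. y N = x N \<longrightarrow> \<phi> (A.\<tau> g \<otimes>\<^bsub>A.odo_grp\<^esub> y) = B.\<tau> h \<otimes>\<^bsub>B.odo_grp\<^esub> \<phi> y"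
    by blast
  have main: "\<phi> (A.\<tau> g) \<in> B.\<tau> ` carrier H \<and>
      (\<forall>u\<in>odometer G \<Gamma>. u N = \<Gamma> N \<longrightarrow> \<phi> (A.\<tau> g \<otimes>\<^bsub>A.odo_grp\<^esub> u) = \<phi> (A.\<tau> g) \<otimes>\<^bsub>B.odo_grp\<^esub> \<phi> u)"
    if g: "g \<in> carrier G" for g
  proof -
    obtain h where h: "h \<in> carrier H" "\<And>u. \<lbrakk>u \<in> odometer G \<Gamma>; u N = \<Gamma> N\<rbrakk> \<Longrightarrow>
        \<phi> (A.\<tau> g \<otimes>\<^bsub>A.odo_grp\<^esub> u) = B.\<tau> h \<otimes>\<^bsub>B.odo_grp\<^esub> \<phi> u"
      using N[OF g, of "\<one>\<^bsub>A.odo_grp\<^esub>"] by auto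
    have "\<phi> (A.\<tau> g) = B.\<tau> h" using h(2)[of "\<one>\<^bsub>A.odo_grp\<^esub>"] g h(1) \<phi>1 by simp
    then show ?thesis using h by auto
  qed
  have "level_right_hom N \<phi>"
    unfolding level_right_hom_def
  proof (intro ballI impI)
    fix x u assume x: "x \<in> odometer G \<Gamma>" and u: "u \<in> odometer G \<Gamma>" "u N = \<Gamma> N"
    \<comment> \<open>For fixed \<open>u\<close>, both sides of the claim are continuous in
      \<open>x\<close>, and \<open>main\<close> equates them on the dense image of
      \<open>G\<close>.\<close>
    have c1: "continuous_map A.T B.T (\<phi> \<circ> (\<lambda>x. x \<otimes>\<^bsub>A.odo_grp\<^esub> u))"
      using homeomorphic_imp_continuous_map[OF A.homeomorphic_map_right_mult[OF u(1)]] \<phi>c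
      by (rule continuous_map_compose)
    have c2: "continuous_map A.T B.T ((\<lambda>y. y \<otimes>\<^bsub>B.odo_grp\<^esub> \<phi> u) \<circ> \<phi>)"
      using \<phi>c homeomorphic_imp_continuous_map[OF B.homeomorphic_map_right_mult[OF \<phi>X[OF u(1)]]]
      by (rule continuous_map_compose)
    have "(\<phi> \<circ> (\<lambda>x. x \<otimes>\<^bsub>A.odo_grp\<^esub> u)) x = ((\<lambda>y. y \<otimes>\<^bsub>B.odo_grp\<^esub> \<phi> u) \<circ> \<phi>) x"
      by (rule eq_if_eq_on_embedding[OF c1 c2 _ x]) (simp add: main u)
    then show "\<phi> (x \<otimes>\<^bsub>A.odo_grp\<^esub> u) = \<phi> x \<otimes>\<^bsub>B.odo_grp\<^esub> \<phi> u" by simp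
  qed
  moreover have "\<phi> ` A.\<tau> ` carrier G \<subseteq> B.\<tau> ` carrier H"
    using main by (auto simp: image_subset_iff)
  ultimately show ?thesis using \<phi>h by blast
qed

text \<open>Inverting before and after \<open>\<phi>\<close> reverses products twice, which turns
  right multiplicativity into the left one that conjugation requires.\<close>

theorem orbit_equivalent_imp_Aut_stabilized_iso:
  assumes fg: "finitely_generated_group G"
    and coe: "continuously_orbit_equivalent A.T (odometer_action G \<Gamma>) G B.T (odometer_action H \<Delta>) H"
  shows "A.Aut_inf \<cong> B.Aut_inf"
proof -
  obtain \<phi> N where \<phi>: "homeomorphic_map A.T B.T \<phi>"
    and hom: "level_right_hom N \<phi>"
    using orbit_equivalence_right_hom[OF fg coe] by blast
  have \<phi>X: "\<phi> x \<in> odometer H \<Delta>" if "x \<in> odometer G \<Gamma>" for x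
    using that homeomorphic_imp_continuous_map[OF \<phi>] by (auto simp: continuous_map_iff)
  define \<psi> where "\<psi> = m_inv B.odo_grp \<circ> (\<phi> \<circ> m_inv A.odo_grp)"
  have "homeomorphic_map A.T B.T \<psi>"
    unfolding \<psi>_def
    by (rule homeomorphic_map_compose[OF homeomorphic_map_compose[OF A.homeomorphic_map_inv \<phi>]
          B.homeomorphic_map_inv])
  then obtain \<theta> where hm: "homeomorphic_maps A.T B.T \<psi> \<theta>"
    unfolding homeomorphic_map_maps by blast
  have "level_hom N \<psi>"
    unfolding level_hom_def
  proof (intro ballI impI)
    fix u x assume u: "u \<in> odometer G \<Gamma>" "u N = \<Gamma> N" and x: "x \<in> odometer G \<Gamma>"
    have "(inv\<^bsub>A.odo_grp\<^esub> u) N = \<Gamma> N"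
      using A.inv_cong_at[of u "\<one>\<^bsub>A.odo_grp\<^esub>" N] u by simp
    then have "\<phi> (inv\<^bsub>A.odo_grp\<^esub> x \<otimes>\<^bsub>A.odo_grp\<^esub> inv\<^bsub>A.odo_grp\<^esub> u) =
        \<phi> (inv\<^bsub>A.odo_grp\<^esub> x) \<otimes>\<^bsub>B.odo_grp\<^esub> \<phi> (inv\<^bsub>A.odo_grp\<^esub> u)"
      using u x hom by (simp add: level_right_hom_def)
    then show "\<psi> (u \<otimes>\<^bsub>A.odo_grp\<^esub> x) = \<psi> u \<otimes>\<^bsub>B.odo_grp\<^esub> \<psi> x"
      using u x \<phi>X by (simp add: \<psi>_def A.X.inv_mult_group B.X.inv_mult_group)
  qed
  then show ?thesis by (rule Aut_stabilized_iso[OF hm])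
qed

end

section \<open>Dense subgroups\<close>

text \<open>Membership only involves pairs of consecutive coordinates, and these are those of some
  embedded \<open>g\<close>.\<close>

lemma in_odometer_if_locally_embedded:
  assumes "group_scale K \<Lambda>" and "\<And>n. \<exists>g\<in>carrier K. \<forall>k\<le>n. x k = odometer_embedding K \<Lambda> g k"
  shows "x \<in> odometer K \<Lambda>"
proof -
  interpret K: odometer_space K \<Lambda> by unfold_locales (rule assms(1))
  have "x n \<in> carrier (K Mod \<Lambda> n) \<and> bonding K \<Lambda> n (x (Suc n)) = x n" for n
  proof -
    obtain g where "g \<in> carrier K" "\<forall>k\<le>Suc n. x k = odometer_embedding K \<Lambda> g k"
      using assms(2) by blast
    then have g: "odometer_embedding K \<Lambda> g \<in> odometer K \<Lambda>"
      "x n = odometer_embedding K \<Lambda> g n" "x (Suc n) = odometer_embedding K \<Lambda> g (Suc n)"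
      by auto
    then show ?thesis unfolding odometer_def by (auto simp: PiE_iff)
  qed
  then show ?thesis by (auto simp: odometer_def)
qed

text \<open>The condition \<open>dense\<close> makes \<open>D\<close> surject onto every quotient,
  that is, its image is dense in the odometer.\<close>

locale dense_subgroup = odometer_space +
  fixes D
  assumes D: "subgroup D G"
    and dense: "\<And>g n. g \<in> carrier G \<Longrightarrow> \<exists>d\<in>D. \<Gamma> n #>\<^bsub>G\<^esub> g = \<Gamma> n #>\<^bsub>G\<^esub> d"
begin

abbreviation H where "H \<equiv> G\<lparr>carrier := D\<rparr>"
abbreviation \<Delta> where "\<Delta> \<equiv> \<lambda>n. \<Gamma> n \<inter> D"

lemma D_carrier: "d \<in> D \<Longrightarrow> d \<in> carrier G"
  using D by (rule subgroup.mem_carrier)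

lemma coset_Int:
  assumes d: "d \<in> D"
  shows "\<Delta> n #>\<^bsub>H\<^esub> d = (\<Gamma> n #>\<^bsub>G\<^esub> d) \<inter> D"
proof (intro equalityI subsetI)
  fix a assume "a \<in> (\<Gamma> n #>\<^bsub>G\<^esub> d) \<inter> D"
  then obtain c where c: "c \<in> \<Gamma> n" "a = c \<otimes>\<^bsub>G\<^esub> d" "a \<in> D" by (auto simp: r_coset_def)
  then have "c = a \<otimes>\<^bsub>G\<^esub> inv\<^bsub>G\<^esub> d"
    using d D_carrier subgroup.mem_carrier[OF normal_imp_subgroup[OF normal_scale]]
    by (simp add: G.inv_solve_right)
  then have "c \<in> D" using c(3) d D by (simp add: subgroup.m_closed subgroup.m_inv_closed)
  then show "a \<in> \<Delta> n #>\<^bsub>H\<^esub> d" using c by (auto simp: r_coset_def)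
qed (use d D in \<open>auto simp: r_coset_def subgroup.m_closed\<close>)

text \<open>Finite index is inherited because the cosets of \<open>\<Delta> n\<close> are traces on
  \<open>D\<close> of cosets of \<open>\<Gamma> n\<close>.\<close>

lemma group_scale_Int: "group_scale H \<Delta>"
  unfolding group_scale_def
proof (intro conjI allI)
  fix n
  show N: "\<Delta> n \<lhd> H" using G.normal_Int_subgroup[OF D normal_scale] .
  have "rcosets\<^bsub>H\<^esub> \<Delta> n \<subseteq> (\<lambda>C. C \<inter> D) ` (rcosets\<^bsub>G\<^esub> \<Gamma> n)"
  proof
    fix C assume "C \<in> rcosets\<^bsub>H\<^esub> \<Delta> n"
    then obtain d where d: "d \<in> D" "C = \<Delta> n #>\<^bsub>H\<^esub> d" by (auto simp: RCOSETS_def)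
    then have "C = (\<Gamma> n #>\<^bsub>G\<^esub> d) \<inter> D" using coset_Int[OF d(1), of n] by (simp only:)
    moreover have "\<Gamma> n #>\<^bsub>G\<^esub> d \<in> rcosets\<^bsub>G\<^esub> \<Gamma> n"
      using D_carrier[OF d(1)] by (auto simp: RCOSETS_def)
    ultimately show "C \<in> (\<lambda>C. C \<inter> D) ` (rcosets\<^bsub>G\<^esub> \<Gamma> n)" by blast
  qed
  moreover have "finite (rcosets\<^bsub>G\<^esub> \<Gamma> n)"
    using scale by (simp add: group_scale_def finite_index_subgroup_def)
  ultimately have "finite (rcosets\<^bsub>H\<^esub> \<Delta> n)" by (meson finite_surj)
  then show "finite_index_subgroup (\<Delta> n) H"
    using N by (simp add: finite_index_subgroup_def normal_imp_subgroup)
next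
  show "decseq \<Delta>" using scale unfolding group_scale_def decseq_def by blast
  show "(\<Inter>n. \<Delta> n) = {\<one>\<^bsub>H\<^esub>}"
    using scale D by (auto simp: group_scale_def subgroup.one_closed)
qed

sublocale P: odometer_pair G \<Gamma> H \<Delta>
  by unfold_locales (rule group_scale_Int)

lemma embedding_Int: "d \<in> D \<Longrightarrow> P.B.\<tau> d n = \<tau> d n \<inter> D"
  using coset_Int[of d n] by (simp add: P.B.embedding_at embedding_at D_carrier)

text \<open>A coset meeting \<open>D\<close> is recovered from its trace on \<open>D\<close>: the
  trace contains \<open>d\<close>, and multiplying by \<open>\<Gamma> n\<close> fills up the
  coset.\<close>

lemma embedding_set_mult:
  assumes d: "d \<in> D" shows "\<tau> d n = \<Gamma> n <#>\<^bsub>G\<^esub> P.B.\<tau> d n"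
proof -
  interpret N: normal "\<Gamma> n" G by (rule normal_scale)
  have "\<Gamma> n <#>\<^bsub>G\<^esub> (\<tau> d n \<inter> D) \<subseteq> \<Gamma> n <#>\<^bsub>G\<^esub> (\<Gamma> n #>\<^bsub>G\<^esub> d)"
    using D_carrier[OF d] by (auto simp: set_mult_def embedding_at)
  also have "\<dots> = \<Gamma> n #>\<^bsub>G\<^esub> d"
    using D_carrier[OF d] by (simp add: G.setmult_rcos_assoc N.subset G.subgroup_mult_id N.subgroup_axioms)
  finally have "\<Gamma> n <#>\<^bsub>G\<^esub> (\<tau> d n \<inter> D) \<subseteq> \<Gamma> n #>\<^bsub>G\<^esub> d" .
  moreover have "\<Gamma> n #>\<^bsub>G\<^esub> d \<subseteq> \<Gamma> n <#>\<^bsub>G\<^esub> (\<tau> d n \<inter> D)"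
  proof
    fix a assume "a \<in> \<Gamma> n #>\<^bsub>G\<^esub> d"
    then obtain h where "h \<in> \<Gamma> n" "a = h \<otimes>\<^bsub>G\<^esub> d" by (auto simp: r_coset_def)
    moreover have "d \<in> \<tau> d n \<inter> D"
      using d D_carrier[OF d] G.rcos_self[OF _ N.subgroup_axioms, of d] by (simp add: embedding_at)
    ultimately show "a \<in> \<Gamma> n <#>\<^bsub>G\<^esub> (\<tau> d n \<inter> D)" unfolding set_mult_def by blast
  qed
  ultimately show ?thesis using d D_carrier[OF d] by (simp add: embedding_Int embedding_at)
qed

lemma dense_le:
  assumes x: "x \<in> odometer G \<Gamma>"
  shows "\<exists>d\<in>D. \<forall>k\<le>n. x k = \<tau> d k"
proof -
  obtain g where g: "g \<in> carrier G" "\<tau> g n = x n" by (rule embedding_dense[OF x])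
  obtain d where d: "d \<in> D" "\<Gamma> n #>\<^bsub>G\<^esub> g = \<Gamma> n #>\<^bsub>G\<^esub> d" using dense[OF g(1)] by blast
  then have "x n = \<tau> d n" using g D_carrier by (simp add: embedding_at)
  then show ?thesis using coset_at_le[OF x D_carrier[OF d(1)]] d(1) by blast
qed

lemma dense_le':
  assumes y: "y \<in> odometer H \<Delta>"
  shows "\<exists>d\<in>D. \<forall>k\<le>n. y k = P.B.\<tau> d k"
proof -
  obtain d where d: "d \<in> carrier H" "P.B.\<tau> d n = y n" by (rule P.B.embedding_dense[OF y])
  have "\<forall>k\<le>n. y k = P.B.\<tau> d k" using P.B.coset_at_le[OF y d(1) d(2)[symmetric]] by blast
  then show ?thesis using d(1) by auto
qed

text \<open>The identification of the two odometers and its inverse \<open>mult_map\<close>: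
  coordinatewise, the trace on \<open>D\<close> and the saturation by
  \<open>\<Gamma> n\<close>.\<close>

definition Int_map :: "(nat \<Rightarrow> 'a set) \<Rightarrow> nat \<Rightarrow> 'a set" where "Int_map x = (\<lambda>n. x n \<inter> D)"
definition mult_map :: "(nat \<Rightarrow> 'a set) \<Rightarrow> nat \<Rightarrow> 'a set" where "mult_map y = (\<lambda>n. \<Gamma> n <#>\<^bsub>G\<^esub> y n)"

lemma Int_map_eq: "d \<in> D \<Longrightarrow> x n = \<tau> d n \<Longrightarrow> Int_map x n = P.B.\<tau> d n"
  by (simp add: Int_map_def embedding_Int)

lemma mult_map_eq: "d \<in> D \<Longrightarrow> y n = P.B.\<tau> d n \<Longrightarrow> mult_map y n = \<tau> d n"
  by (simp add: mult_map_def embedding_set_mult)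

text \<open>Coordinate \<open>n\<close> of either image depends on coordinate \<open>n\<close>
  alone, whence continuity. All other claims reduce to embedded elements of \<open>D\<close>, since
  every point agrees with one up to any given level.\<close>

lemma homeomorphic_maps_Int: "homeomorphic_maps T P.B.T Int_map mult_map"
proof -
  have I: "Int_map x \<in> odometer H \<Delta>" if x: "x \<in> odometer G \<Gamma>" for x
    using dense_le[OF x] Int_map_eq
    by (intro in_odometer_if_locally_embedded[OF group_scale_Int]) (simp, meson)
  have M: "mult_map y \<in> odometer G \<Gamma>" if y: "y \<in> odometer H \<Delta>" for y
    using dense_le'[OF y] mult_map_eq D_carrier
    by (intro in_odometer_if_locally_embedded[OF scale]) meson
  have "continuous_map T P.B.T Int_map"
    unfolding P.continuous_map_iff
  proof (intro conjI ballI allI)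
    show "\<exists>k. \<forall>y\<in>odometer G \<Gamma>. y k = x k \<longrightarrow> Int_map y n = Int_map x n" for x n
      by (intro exI[of _ n]) (simp add: Int_map_def)
  qed (use I in blast)
  moreover have "continuous_map P.B.T T mult_map"
    unfolding P.converse.continuous_map_iff
  proof (intro conjI ballI allI)
    show "\<exists>k. \<forall>y\<in>odometer H \<Delta>. y k = x k \<longrightarrow> mult_map y n = mult_map x n" for x n
      by (intro exI[of _ n]) (simp add: mult_map_def)
  qed (use M in blast)
  moreover have "mult_map (Int_map x) = x" if x: "x \<in> odometer G \<Gamma>" for x
  proof
    fix n
    obtain d where "d \<in> D" "x n = \<tau> d n" using dense_le[OF x, of n] by blast
    then show "mult_map (Int_map x) n = x n" using Int_map_eq mult_map_eq by metis
  qed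
  moreover have "Int_map (mult_map y) = y" if y: "y \<in> odometer H \<Delta>" for y
  proof
    fix n
    obtain d where "d \<in> D" "y n = P.B.\<tau> d n" using dense_le'[OF y, of n] by blast
    then show "Int_map (mult_map y) n = y n" using Int_map_eq mult_map_eq by metis
  qed
  ultimately show ?thesis by (simp add: homeomorphic_maps_def)
qed

theorem Aut_stabilized_dense_subgroup: "Aut_inf \<cong> P.B.Aut_inf"
proof (rule P.Aut_stabilized_iso[OF homeomorphic_maps_Int])
  \<comment> \<open>\<open>Int_map\<close> is multiplicative on the whole odometer, so any level
    would do.\<close>
  show "P.level_hom 0 Int_map"
    unfolding P.level_hom_def
  proof (intro ballI impI)
    fix u x assume u: "u \<in> odometer G \<Gamma>" and x: "x \<in> odometer G \<Gamma>"
    show "Int_map (u \<otimes>\<^bsub>odo_grp\<^esub> x) = Int_map u \<otimes>\<^bsub>P.B.odo_grp\<^esub> Int_map x"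
    proof
      fix n
      obtain d where d: "d \<in> D" "u n = \<tau> d n" using dense_le[OF u, of n] by blast
      obtain e where e: "e \<in> D" "x n = \<tau> e n" using dense_le[OF x, of n] by blast
      have de: "d \<otimes>\<^bsub>G\<^esub> e \<in> D" using d e D by (simp add: subgroup.m_closed)
      have "(u \<otimes>\<^bsub>odo_grp\<^esub> x) n = \<tau> (d \<otimes>\<^bsub>G\<^esub> e) n"
        using d e D_carrier by (simp add: mult_at)
      then have "Int_map (u \<otimes>\<^bsub>odo_grp\<^esub> x) n = P.B.\<tau> (d \<otimes>\<^bsub>G\<^esub> e) n" by (rule Int_map_eq[OF de])
      also have "\<dots> = (P.B.\<tau> d \<otimes>\<^bsub>P.B.odo_grp\<^esub> P.B.\<tau> e) n"
        using P.B.\<tau>.hom_mult[of d e] d e by simp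
      also have "\<dots> = (Int_map u \<otimes>\<^bsub>P.B.odo_grp\<^esub> Int_map x) n"
        using Int_map_eq d e by (simp add: P.B.mult_at)
      finally show "Int_map (u \<otimes>\<^bsub>odo_grp\<^esub> x) n = (Int_map u \<otimes>\<^bsub>P.B.odo_grp\<^esub> Int_map x) n" .
    qed
  qed
qed

end

section \<open>The converse fails\<close>

text \<open>\<open>ZZ\<close> is \<open>\<int>\<^sup>2\<close>, carried over to the natural numbers.\<close>

definition enc :: "int \<times> int \<Rightarrow> nat"
  where "enc p = prod_encode (int_encode (fst p), int_encode (snd p))"

definition dec :: "nat \<Rightarrow> int \<times> int"
  where "dec k = map_prod int_decode int_decode (prod_decode k)"

lemma dec_enc [simp]: "dec (enc p) = p"
  by (simp add: dec_def enc_def)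

lemma enc_dec [simp]: "enc (dec k) = k"
proof -
  have "(int_encode (fst (dec k)), int_encode (snd (dec k))) = prod_decode k"
    by (simp add: dec_def prod_eq_iff)
  then show ?thesis by (simp add: enc_def)
qed

lemma dec_eq_iff: "dec a = dec b \<longleftrightarrow> a = b"
  by (metis enc_dec)

definition ZZ :: "nat monoid"
  where "ZZ = \<lparr>carrier = UNIV, monoid.mult = \<lambda>a b. enc (dec a + dec b), one = enc 0\<rparr>"

lemma ZZ_simps [simp]:
  "carrier ZZ = UNIV" "a \<otimes>\<^bsub>ZZ\<^esub> b = enc (dec a + dec b)" "\<one>\<^bsub>ZZ\<^esub> = enc 0"
  by (simp_all add: ZZ_def)

interpretation ZZ: comm_group ZZ
proof (rule comm_groupI)
  show "\<exists>b\<in>carrier ZZ. b \<otimes>\<^bsub>ZZ\<^esub> a = \<one>\<^bsub>ZZ\<^esub>" for a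
    by (intro bexI[of _ "enc (- dec a)"]) simp_all
qed (simp_all add: ac_simps)

lemma inv_ZZ [simp]: "inv\<^bsub>ZZ\<^esub> a = enc (- dec a)"
  by (rule ZZ.inv_equality) simp_all

definition box :: "nat \<Rightarrow> nat set"
  where "box n = {a. 2 ^ n dvd fst (dec a) \<and> 3 ^ n dvd snd (dec a)}"

definition diag :: "nat set"
  where "diag = {a. fst (dec a) = snd (dec a)}"

lemma subgroup_box: "subgroup (box n) ZZ"
  by (rule ZZ.subgroupI) (auto simp: box_def intro!: exI[of _ "enc 0"])

lemma subgroup_diag: "subgroup diag ZZ"
  by (rule ZZ.subgroupI) (auto simp: diag_def intro!: exI[of _ "enc 0"])

lemma box_coset_eq:
  assumes "[fst (dec a) = fst (dec b)] (mod 2 ^ n)" and "[snd (dec a) = snd (dec b)] (mod 3 ^ n)"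
  shows "box n #>\<^bsub>ZZ\<^esub> a = box n #>\<^bsub>ZZ\<^esub> b"
proof (rule ZZ.repr_independence[OF _ _ subgroup_box, symmetric])
  have "enc (dec a - dec b) \<in> box n"
    using assms by (simp add: box_def cong_iff_dvd_diff)
  moreover have "a = enc (dec a - dec b) \<otimes>\<^bsub>ZZ\<^esub> b" by simp
  ultimately show "a \<in> box n #>\<^bsub>ZZ\<^esub> b" unfolding r_coset_def by blast
qed simp

text \<open>A nonzero \<open>k\<close> is too small to be divisible by \<open>b\<close> to the power
  \<open>\<bar>k\<bar>\<close>, which exceeds \<open>\<bar>k\<bar>\<close>.\<close>

lemma eq_0_if_powers_dvd:
  fixes k b :: int
  assumes "b \<ge> 2" and "\<And>n. b ^ n dvd k"
  shows "k = 0"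
proof (rule ccontr)
  assume "k \<noteq> 0"
  then have "b ^ nat \<bar>k\<bar> \<le> \<bar>k\<bar>" using assms(1) dvd_imp_le_int[OF _ assms(2)] by fastforce
  moreover have "2 ^ nat \<bar>k\<bar> \<le> b ^ nat \<bar>k\<bar>" using assms(1) by (intro power_mono) auto
  moreover have "\<bar>k\<bar> < 2 ^ nat \<bar>k\<bar>"
    using of_nat_less_two_power[of "nat \<bar>k\<bar>", where 'a = int] by simp
  ultimately show False by linarith
qed

lemma group_scale_box: "group_scale ZZ box"
  unfolding group_scale_def
proof (intro conjI allI)
  fix n
  show "box n \<lhd> ZZ" by (rule ZZ.subgroup_imp_normal[OF subgroup_box])
  \<comment> \<open>Reducing the two coordinates to residues puts a representative of each coset in
    a finite rectangle.\<close>
  have "rcosets\<^bsub>ZZ\<^esub> box n \<subseteq> (\<lambda>p. box n #>\<^bsub>ZZ\<^esub> enc p) ` ({0..<2 ^ n} \<times> {0..<3 ^ n})"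
  proof
    fix C assume "C \<in> rcosets\<^bsub>ZZ\<^esub> box n"
    then obtain a where "C = box n #>\<^bsub>ZZ\<^esub> a" by (auto simp: RCOSETS_def)
    also have "\<dots> = box n #>\<^bsub>ZZ\<^esub> enc (fst (dec a) mod 2 ^ n, snd (dec a) mod 3 ^ n)"
      by (rule box_coset_eq) (simp_all add: cong_def)
    finally show "C \<in> (\<lambda>p. box n #>\<^bsub>ZZ\<^esub> enc p) ` ({0..<2 ^ n} \<times> {0..<3 ^ n})"
      by (rule image_eqI) simp
  qed
  then show "finite_index_subgroup (box n) ZZ"
    unfolding finite_index_subgroup_def using subgroup_box
    by (meson finite_surj finite_SigmaI finite_atLeastLessThan_int)
next
  show "decseq box"
    by (auto simp: decseq_Suc_iff box_def intro: dvd_trans[OF le_imp_power_dvd])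
  have "a = enc 0" if "\<And>n. a \<in> box n" for a
  proof -
    have "fst (dec a) = 0" "snd (dec a) = 0"
      using that by (auto simp: box_def intro: eq_0_if_powers_dvd[of 2] eq_0_if_powers_dvd[of 3])
    then have "dec a = 0" by (simp add: prod_eq_iff)
    then show ?thesis by (metis enc_dec)
  qed
  then show "(\<Inter>n. box n) = {\<one>\<^bsub>ZZ\<^esub>}" by (auto simp: box_def)
qed

interpretation ZZ: dense_subgroup ZZ box diag
proof (intro dense_subgroup.intro odometer_space.intro dense_subgroup_axioms.intro)
  fix a :: nat and n :: nat
  have "coprime (2 ^ n :: int) (3 ^ n)" by simp
  \<comment> \<open>The Chinese remainder theorem provides a diagonal element \<open>(x, x)\<close>
    in the coset of \<open>a\<close>.\<close>
  then obtain x :: int where "[x = fst (dec a)] (mod 2 ^ n)" "[x = snd (dec a)] (mod 3 ^ n)"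
    using binary_chinese_remainder_int by blast
  then have "box n #>\<^bsub>ZZ\<^esub> a = box n #>\<^bsub>ZZ\<^esub> enc (x, x)"
    by (intro box_coset_eq) (simp_all add: cong_sym)
  then show "\<exists>d\<in>diag. box n #>\<^bsub>ZZ\<^esub> a = box n #>\<^bsub>ZZ\<^esub> d"
    by (intro bexI[of _ "enc (x, x)"]) (simp_all add: diag_def)
qed (rule group_scale_box subgroup_diag)+

text \<open>Induction over the integers in both directions, adding or subtracting \<open>p\<close>;
  used for the generators of \<open>ZZ\<close> and of \<open>diag\<close>.\<close>

lemma multiples_in_generate:
  assumes S: "enc p \<in> S"
  shows "enc (k * fst p, k * snd p) \<in> generate ZZ S"
proof (induction k rule: int_induct[where k = 0])
  case base
  show ?case using generate.one[of ZZ S] by (simp add: zero_prod_def)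
next
  case (step1 i)
  have "enc (i * fst p, i * snd p) \<otimes>\<^bsub>ZZ\<^esub> enc p = enc ((i + 1) * fst p, (i + 1) * snd p)"
    by (cases p) (simp add: algebra_simps)
  then show ?case using generate.eng[OF step1.IH generate.incl[OF S]] by metis
next
  case (step2 i)
  have "enc (i * fst p, i * snd p) \<otimes>\<^bsub>ZZ\<^esub> inv\<^bsub>ZZ\<^esub> enc p = enc ((i - 1) * fst p, (i - 1) * snd p)"
    by (cases p) (simp add: algebra_simps)
  then show ?case using generate.eng[OF step2.IH generate.inv[OF S]] by metis
qed

lemma finitely_generated_ZZ: "finitely_generated_group ZZ"
  unfolding finitely_generated_group_def
proof (intro conjI exI)
  let ?S = "{enc (1, 0), enc (0, 1)}"
  have "a \<in> generate ZZ ?S" for a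
  proof -
    have "enc (fst (dec a), 0) \<in> generate ZZ ?S" "enc (0, snd (dec a)) \<in> generate ZZ ?S"
      using multiples_in_generate[of "(1, 0)" ?S "fst (dec a)"]
        multiples_in_generate[of "(0, 1)" ?S "snd (dec a)"] by simp_all
    then have "enc (fst (dec a), 0) \<otimes>\<^bsub>ZZ\<^esub> enc (0, snd (dec a)) \<in> generate ZZ ?S"
      by (rule generate.eng)
    then show ?thesis by simp
  qed
  then show "generate ZZ ?S = carrier ZZ" by auto
qed (auto intro: ZZ.group_axioms)

lemma finitely_generated_diag: "finitely_generated_group (ZZ\<lparr>carrier := diag\<rparr>)"
  unfolding finitely_generated_group_def
proof (intro conjI exI)
  let ?S = "{enc (1, 1)}"
  have S: "?S \<subseteq> diag" by (simp add: diag_def)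
  have "a \<in> generate ZZ ?S" if "a \<in> diag" for a
  proof -
    have "(fst (dec a), fst (dec a)) = dec a" using that by (simp add: diag_def prod_eq_iff)
    then show ?thesis
      using multiples_in_generate[of "(1, 1)" ?S "fst (dec a)"] by simp
  qed
  then show "generate (ZZ\<lparr>carrier := diag\<rparr>) ?S = carrier (ZZ\<lparr>carrier := diag\<rparr>)"
    using ZZ.generate_consistent[OF S subgroup_diag] ZZ.generate_subgroup_incl[OF S subgroup_diag]
    by auto
qed (use ZZ.subgroup_imp_group[OF subgroup_diag] in \<open>auto simp: diag_def\<close>)

lemma infinite_ZZ: "infinite (carrier ZZ)"
  by simp

lemma infinite_diag: "infinite (carrier (ZZ\<lparr>carrier := diag\<rparr>))"
proof -
  have "inj (\<lambda>k. enc (k, k))" by (rule injI) (metis dec_enc prod.inject)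
  then have "infinite (range (\<lambda>k. enc (k, k)))" using finite_imageD infinite_UNIV_int by blast
  moreover have "range (\<lambda>k. enc (k, k)) \<subseteq> diag" by (auto simp: diag_def)
  ultimately show ?thesis using finite_subset by auto
qed

section \<open>No embedding of the rank two group into the integers, and the failure of orbit
  equivalence\<close>

lemma additive_int_eq:
  fixes f :: "int \<Rightarrow> int"
  assumes "\<And>x y. f (x + y) = f x + f y"
  shows "f k = k * f 1"
proof (induction k rule: int_induct[where k = 0])
  case base show ?case using assms[of 0 0] by simp
next
  case (step1 i) then show ?case using assms[of i 1] by (simp add: algebra_simps)
next
  case (step2 i) then show ?case using assms[of "i - 1" 1] by (simp add: algebra_simps)
qed

text \<open>With \<open>a = r (1, 0)\<close> and \<open>b = r (0, 1)\<close>, the vector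
  \<open>(b, - a)\<close> is in the kernel. Injectivity forces \<open>a = 0\<close>, which puts
  \<open>(1, 0)\<close> in the kernel.\<close>

lemma additive_int_pair_not_inj:
  fixes r :: "int \<times> int \<Rightarrow> int"
  assumes add: "\<And>p q. r (p + q) = r p + r q"
  shows "\<not> inj r"
proof
  assume inj: "inj r"
  have "r (i, j) = i * r (1, 0) + j * r (0, 1)" for i j
  proof -
    have "r (i, 0) = i * r (1, 0)"
      using additive_int_eq[of "\<lambda>i. r (i, 0)" i] add[of "(_, 0)" "(_, 0)"] by simp
    moreover have "r (0, j) = j * r (0, 1)"
      using additive_int_eq[of "\<lambda>j. r (0, j)" j] add[of "(0, _)" "(0, _)"] by simp
    ultimately show ?thesis using add[of "(i, 0)" "(0, j)"] by simp
  qed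
  note r = this
  have "r (r (0, 1), - r (1, 0)) = r (0, 0)" unfolding r[of "r (0, 1)"] r[of 0 0] by simp
  then have "r (1, 0) = 0" using inj by (auto dest: injD)
  then have "r (1, 0) = r (0, 0)" using r[of 0 0] by simp
  then show False using inj by (auto dest: injD)
qed

text \<open>On the embedded copy of \<open>box N\<close> an orbit equivalence, normalized as above,
  is an injective homomorphism into the embedded \<open>diag\<close>; that is, the rank two group
  would embed in the integers.\<close>

lemma not_orbit_equivalent:
  "\<not> continuously_orbit_equivalent
      (odometer_topology ZZ box) (odometer_action ZZ box) ZZ
      (odometer_topology (ZZ\<lparr>carrier := diag\<rparr>) (\<lambda>n. box n \<inter> diag))
      (odometer_action (ZZ\<lparr>carrier := diag\<rparr>) (\<lambda>n. box n \<inter> diag)) (ZZ\<lparr>carrier := diag\<rparr>)"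
proof
  assume "continuously_orbit_equivalent
      (odometer_topology ZZ box) (odometer_action ZZ box) ZZ
      (odometer_topology (ZZ\<lparr>carrier := diag\<rparr>) (\<lambda>n. box n \<inter> diag))
      (odometer_action (ZZ\<lparr>carrier := diag\<rparr>) (\<lambda>n. box n \<inter> diag)) (ZZ\<lparr>carrier := diag\<rparr>)"
  from ZZ.P.orbit_equivalence_right_hom[OF finitely_generated_ZZ this]
  obtain \<phi> N where hm: "homeomorphic_map ZZ.T ZZ.P.B.T \<phi>" and hom: "ZZ.P.level_right_hom N \<phi>"
    and im: "\<phi> ` ZZ.\<tau> ` carrier ZZ \<subseteq> ZZ.P.B.\<tau> ` carrier (ZZ\<lparr>carrier := diag\<rparr>)"
    by blast
  have inj_\<phi>: "inj_on \<phi> (odometer ZZ box)"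
    using hm by (simp add: homeomorphic_eq_everything_map)
  have "\<phi> (ZZ.\<tau> a) \<in> ZZ.P.B.\<tau> ` diag" for a using im by (simp add: image_subset_iff)
  then have "\<exists>h\<in>diag. \<phi> (ZZ.\<tau> a) = ZZ.P.B.\<tau> h" for a by blast
  then obtain h where h: "\<And>a. h a \<in> diag" "\<And>a. \<phi> (ZZ.\<tau> a) = ZZ.P.B.\<tau> (h a)"
    by metis
  \<comment> \<open>\<open>s\<close> parametrizes \<open>box N\<close> by integer pairs, and
    \<open>r\<close> below reads the corresponding diagonal element as an integer.\<close>
  define s :: "int \<times> int \<Rightarrow> nat" where "s p = enc (2 ^ N * fst p, 3 ^ N * snd p)" for p
  have s: "s p \<in> box N" for p by (simp add: s_def box_def)
  define r where "r p = fst (dec (h (s p)))" for p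
  have dec_h: "dec (h a) = (fst (dec (h a)), fst (dec (h a)))" for a
    using h(1)[of a] by (simp add: diag_def prod_eq_iff)
  have "r (p + q) = r p + r q" for p q
  proof -
    have "ZZ.\<tau> (s q) N = box N" using ZZ.embedding_one_at_iff s by simp
    then have "\<phi> (ZZ.\<tau> (s p) \<otimes>\<^bsub>ZZ.odo_grp\<^esub> ZZ.\<tau> (s q)) =
        \<phi> (ZZ.\<tau> (s p)) \<otimes>\<^bsub>ZZ.P.B.odo_grp\<^esub> \<phi> (ZZ.\<tau> (s q))"
      using hom by (simp add: ZZ.P.level_right_hom_def)
    moreover have "ZZ.\<tau> (s p) \<otimes>\<^bsub>ZZ.odo_grp\<^esub> ZZ.\<tau> (s q) = ZZ.\<tau> (s (p + q))"
      using ZZ.\<tau>.hom_mult[of "s p" "s q"] by (simp add: s_def algebra_simps)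
    moreover have "ZZ.P.B.\<tau> (h (s p)) \<otimes>\<^bsub>ZZ.P.B.odo_grp\<^esub> ZZ.P.B.\<tau> (h (s q)) =
        ZZ.P.B.\<tau> (enc (dec (h (s p)) + dec (h (s q))))"
      using ZZ.P.B.\<tau>.hom_mult[of "h (s p)" "h (s q)"] h(1) by simp
    ultimately have "ZZ.P.B.\<tau> (h (s (p + q))) = ZZ.P.B.\<tau> (enc (dec (h (s p)) + dec (h (s q))))"
      using h(2) by simp
    moreover have "enc (dec (h (s p)) + dec (h (s q))) \<in> diag"
      using h(1)[of "s p"] h(1)[of "s q"] by (simp add: diag_def)
    ultimately have "h (s (p + q)) = enc (dec (h (s p)) + dec (h (s q)))"
      using ZZ.P.B.embedding_inj h(1) by (simp add: inj_on_def)
    then show ?thesis by (simp add: r_def)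
  qed
  moreover have "inj r"
  proof (rule injI)
    fix p q assume "r p = r q"
    then have "h (s p) = h (s q)" using dec_h[of "s p"] dec_h[of "s q"]
      by (simp add: r_def flip: dec_eq_iff)
    then have "ZZ.\<tau> (s p) = ZZ.\<tau> (s q)"
      using h(2)[of "s p"] h(2)[of "s q"] inj_\<phi> by (simp add: inj_on_def)
    then have "s p = s q" using ZZ.embedding_inj by (simp add: inj_on_def)
    then have "dec (s p) = dec (s q)" by simp
    then show "p = q" by (simp add: s_def prod_eq_iff)
  qed
  ultimately show False using additive_int_pair_not_inj by blast
qed

theorem corollary5p1:
  shows "(\<forall>(G :: ('a, 'm) monoid_scheme) (H :: ('b, 'k) monoid_scheme) \<Gamma> \<Delta>.
            infinite (carrier G) \<and> finitely_generated_group G \<and> residually_finite_group G \<and>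
            infinite (carrier H) \<and> finitely_generated_group H \<and> residually_finite_group H \<and>
            group_scale G \<Gamma> \<and> group_scale H \<Delta> \<and>
            continuously_orbit_equivalent
              (odometer_topology G \<Gamma>) (odometer_action G \<Gamma>) G
              (odometer_topology H \<Delta>) (odometer_action H \<Delta>) H
            \<longrightarrow> Aut_stabilized (odometer_topology G \<Gamma>) (odometer_action G \<Gamma>) G
                \<cong> Aut_stabilized (odometer_topology H \<Delta>) (odometer_action H \<Delta>) H)
       \<and> (\<exists>(G :: nat monoid) (H :: nat monoid) \<Gamma> \<Delta>.
            infinite (carrier G) \<and> finitely_generated_group G \<and> residually_finite_group G \<and>
            infinite (carrier H) \<and> finitely_generated_group H \<and> residually_finite_group H \<and>
            group_scale G \<Gamma> \<and> group_scale H \<Delta> \<and>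
            Aut_stabilized (odometer_topology G \<Gamma>) (odometer_action G \<Gamma>) G
              \<cong> Aut_stabilized (odometer_topology H \<Delta>) (odometer_action H \<Delta>) H \<and>
            \<not> continuously_orbit_equivalent
                (odometer_topology G \<Gamma>) (odometer_action G \<Gamma>) G
                (odometer_topology H \<Delta>) (odometer_action H \<Delta>) H)"
proof (intro conjI allI impI)
  fix G :: "('a, 'm) monoid_scheme" and H :: "('b, 'k) monoid_scheme" and \<Gamma> \<Delta>
  assume *: "infinite (carrier G) \<and> finitely_generated_group G \<and> residually_finite_group G \<and>
    infinite (carrier H) \<and> finitely_generated_group H \<and> residually_finite_group H \<and>
    group_scale G \<Gamma> \<and> group_scale H \<Delta> \<and>
    continuously_orbit_equivalent
      (odometer_topology G \<Gamma>) (odometer_action G \<Gamma>) G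
      (odometer_topology H \<Delta>) (odometer_action H \<Delta>) H"
  then interpret odometer_pair G \<Gamma> H \<Delta> by unfold_locales blast+
  show "A.Aut_inf \<cong> B.Aut_inf" using * by (intro orbit_equivalent_imp_Aut_stabilized_iso) blast+
qed (rule exI[of _ ZZ], rule exI[of _ "ZZ\<lparr>carrier := diag\<rparr>"], rule exI[of _ box],
    rule exI[of _ "\<lambda>n. box n \<inter> diag"],
    intro conjI infinite_ZZ infinite_diag finitely_generated_ZZ finitely_generated_diag
      ZZ.residually_finite ZZ.P.B.residually_finite group_scale_box ZZ.group_scale_Int
      ZZ.Aut_stabilized_dense_subgroup not_orbit_equivalent)

end
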